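(* For all integers $n \ge 8$, $ar_{\mathcal{P}}(n, C_6) \le \dfrac{17(n-2)}{6}$; and for all integers $n \ge 13$, $ar_{\mathcal{P}}(n, C_7) \le \dfrac{59n - 113}{20}$.
   Context: All graphs are finite and simple. $C_k$ is the cycle on $k$ vertices. A plane triangulation is a plane graph in which every face (including the outer face) is bounded by a triangle. For a planar graph $H$ and $n \ge |H|$ (where $|H|$ is the number of vertices of $H$), $\mathcal{T}_n(H)$ is the family of all plane triangulations on $n$ vertices that contain a (not necessarily induced) subgraph isomorphic to $H$. Edge-colorings are arbitrary (not necessarily proper). A subgraph of an edge-colored graph is rainbow if all its edges have different colors. The planar anti-Ramsey number $ar_{\mathcal{P}}(n,H)$ is the maximum number of colors used in an edge-coloring of a plane triangulation $T \in \mathcal{T}_n(H)$ such that $T$ contains no rainbow copy of $H$ (the maximum is over all $T\in\mathcal{T}_n(H)$ and all such colorings of $T$). *)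

theory Defs
  imports "HOL-Analysis.Analysis"
begin

record 'a graph =
  verts :: "'a set"
  edges :: "'a set set"

definition simple_graph :: "('a, 'm) graph_scheme \<Rightarrow> bool" where
  "simple_graph G \<longleftrightarrow>
     finite (verts G) \<and>
     (\<forall>e\<in>edges G. \<exists>u\<in>verts G. \<exists>v\<in>verts G. u \<noteq> v \<and> e = {u, v})"

definition subgraph_of :: "'a graph \<Rightarrow> ('a, 'm) graph_scheme \<Rightarrow> bool" where
  "subgraph_of S G \<longleftrightarrow> simple_graph S \<and> verts S \<subseteq> verts G \<and> edges S \<subseteq> edges G"

definition graph_iso :: "'a graph \<Rightarrow> 'b graph \<Rightarrow> bool" where
  "graph_iso G H \<longleftrightarrow>
     (\<exists>f. bij_betw f (verts G) (verts H) \<and>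
          (\<forall>u\<in>verts G. \<forall>v\<in>verts G. {u, v} \<in> edges G \<longleftrightarrow> {f u, f v} \<in> edges H))"

text \<open>A copy of \<open>H\<close> in \<open>G\<close> is a (not necessarily induced) subgraph of \<open>G\<close> isomorphic to \<open>H\<close>.\<close>

definition copy_of :: "'a graph \<Rightarrow> 'b graph \<Rightarrow> ('a, 'm) graph_scheme \<Rightarrow> bool" where
  "copy_of S H G \<longleftrightarrow> subgraph_of S G \<and> graph_iso S H"

definition rainbow :: "('a set \<Rightarrow> 'c) \<Rightarrow> 'a graph \<Rightarrow> bool" where
  "rainbow c S \<longleftrightarrow> inj_on c (edges S)"

text \<open>The cycle on \<open>k\<close> vertices; meaningful for \<open>k \<ge> 3\<close>.\<close>

definition cycle_graph :: "nat \<Rightarrow> nat graph" where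
  "cycle_graph k = \<lparr>verts = {..<k}, edges = (\<lambda>i. {i, (i + 1) mod k}) ` {..<k}\<rparr>"

text \<open>
  The plane is modelled by the type of complex numbers.  The vertices of a plane graph are
  points, and an edge, identified by its set of two endpoints, is drawn as the point set
  \<open>curve G e\<close>.
\<close>

record plane_graph = "complex graph" +
  curve :: "complex set \<Rightarrow> complex set"

text \<open>
  Every edge is drawn as a simple arc joining its endpoints, and the interior of the arc
  contains no vertex and no point of any other edge.
\<close>

definition is_plane_graph :: "plane_graph \<Rightarrow> bool" where
  "is_plane_graph G \<longleftrightarrow>
     simple_graph G \<and>
     (\<forall>e\<in>edges G. \<exists>g. arc g \<and> path_image g = curve G e \<and> e = {pathstart g, pathfinish g}) \<and>
     (\<forall>e\<in>edges G. (curve G e - e) \<inter> verts G = {}) \<and>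
     (\<forall>e\<in>edges G. \<forall>e'\<in>edges G. e \<noteq> e' \<longrightarrow> (curve G e - e) \<inter> curve G e' = {})"

text \<open>The outer face is the unbounded component.\<close>

definition faces :: "plane_graph \<Rightarrow> complex set set" where
  "faces G = components (- (verts G \<union> (\<Union>e\<in>edges G. curve G e)))"

definition plane_triangulation :: "plane_graph \<Rightarrow> bool" where
  "plane_triangulation G \<longleftrightarrow>
     is_plane_graph G \<and>
     (\<forall>F\<in>faces G. \<exists>u v w. u \<noteq> v \<and> v \<noteq> w \<and> u \<noteq> w \<and>
        {u, v} \<in> edges G \<and> {v, w} \<in> edges G \<and> {u, w} \<in> edges G \<and>
        frontier F = curve G {u, v} \<union> curve G {v, w} \<union> curve G {u, w})"

definition triangulations_containing :: "nat \<Rightarrow> 'b graph \<Rightarrow> plane_graph set" where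
  "triangulations_containing n H =
     {T. plane_triangulation T \<and> card (verts T) = n \<and> (\<exists>S. copy_of S H T)}"

text \<open>The numbers of colors used by the edge-colorings without a rainbow copy of \<open>H\<close>.
  As graphs are finite, colors may be taken to be natural numbers.\<close>

definition rainbow_free_color_counts :: "nat \<Rightarrow> 'b graph \<Rightarrow> nat set" where
  "rainbow_free_color_counts n H =
     {card (c ` edges T) | T (c :: complex set \<Rightarrow> nat).
        T \<in> triangulations_containing n H \<and> \<not> (\<exists>S. copy_of S H T \<and> rainbow c S)}"

text \<open>The supremum is a maximum whenever some such coloring exists, see
  \<open>planar_anti_ramsey_eq_Max\<close> below; otherwise it is \<open>0\<close>.\<close>

definition planar_anti_ramsey :: "nat \<Rightarrow> 'b graph \<Rightarrow> nat" where
  "planar_anti_ramsey n H = Sup (rainbow_free_color_counts n H)"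

lemma finite_rainbow_free_color_counts: "finite (rainbow_free_color_counts n H)"
proof -
  have "k \<le> 2 ^ n" if k: "k \<in> rainbow_free_color_counts n H" for k
  proof -
    from k obtain T and c :: "complex set \<Rightarrow> nat"
      where T: "T \<in> triangulations_containing n H" and kc: "k = card (c ` edges T)"
      unfolding rainbow_free_color_counts_def by blast
    from T have fin: "finite (verts T)" and n: "card (verts T) = n"
      and sub: "edges T \<subseteq> Pow (verts T)"
      by (auto simp: triangulations_containing_def plane_triangulation_def
          is_plane_graph_def simple_graph_def)
    from fin sub have "finite (edges T)"
      by (meson finite_Pow_iff finite_subset)
    then have "k \<le> card (edges T)"
      unfolding kc by (rule card_image_le)
    also have "\<dots> \<le> card (Pow (verts T))"
      using fin sub by (intro card_mono) auto
    finally show ?thesis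
      using fin n by (simp add: card_Pow)
  qed
  then show ?thesis
    by (meson finite_nat_set_iff_bounded_le)
qed

lemma planar_anti_ramsey_eq_Max:
  assumes "rainbow_free_color_counts n H \<noteq> {}"
  shows "planar_anti_ramsey n H = Max (rainbow_free_color_counts n H)"
  using assms finite_rainbow_free_color_counts
  unfolding planar_anti_ramsey_def by (rule cSup_eq_Max[rotated])

end

theory Submission
  imports Defs
begin

text \<open>
  Keep one edge of each color. The \<open>m\<close> deleted edges meet every copy of \<open>C\<^sub>k\<close>, and since the
  triangulation contains such a copy that was not rainbow, \<open>m \<ge> 1\<close>. A triangle face is broken if
  it has a deleted edge, so there are at most \<open>2m\<close> broken faces, and these have at most \<open>4m\<close>
  remaining edges. The other faces fall into regions connected through common edges. A region with
  at least 6 vertices contains a \<open>C\<^sub>6\<close>, and one with at least 8 vertices contains a \<open>C\<^sub>7\<close>: grow the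
  region triangle by triangle; a triangle \<open>uvx\<close> with a new vertex \<open>x\<close> closes a path of the right
  length from \<open>u\<close> to \<open>v\<close> to a cycle, apart from one exceptional position on seven vertices. Hence
  every region has at most 5 (respectively 7) vertices and so few faces compared with its border,
  which has at least 3 edges by parity. Altogether the triangulation has at most \<open>12m\<close>
  (respectively \<open>40m\<close>) faces, and Euler's formula turns this into the bound on the number of colors.

  Only the inequality \<open>F \<ge> E - V + 2\<close> of Euler's formula is needed; it follows from the Jordan curve
  theorem by adding the edges one at a time.
\<close>

section \<open>Jordan curves\<close>

text \<open>The inverse of \<open>g\<close> would embed a disc of the image into the real line. A
  disc without one point is still connected, while its image would miss an intermediate
  value.\<close>

lemma interior_arc_image_empty:
  fixes g :: "real \<Rightarrow> complex"
  assumes "arc g"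
  shows "interior (path_image g) = {}"
proof (rule ccontr)
  assume "interior (path_image g) \<noteq> {}"
  then obtain x where "x \<in> interior (path_image g)" by blast
  then obtain r where r: "r > 0" "ball x r \<subseteq> path_image g"
    using mem_interior by blast
  obtain h where h: "homeomorphism {0..1} (path_image g) g h"
    using homeomorphism_arc[OF assms] by blast
  have conth: "continuous_on (path_image g) h"
    using h by (simp add: homeomorphism_def)
  have injh: "inj_on h (path_image g)"
    using h by (metis homeomorphism_def inj_on_inverseI)
  have inj: "inj_on h (ball x r)"
    using injh r(2) by (rule inj_on_subset)
  have "infinite (ball x r)"
    using r(1) finite_imp_not_open[of "ball x r"] by auto
  then have "infinite (h ` ball x r)"
    using inj finite_imageD by blast
  then obtain A where A: "A \<subseteq> h ` ball x r" "card A = 3" "finite A"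
    by (meson infinite_arbitrarily_large)
  then obtain a b c where abc: "A = {a, b, c}" "a \<noteq> b" "b \<noteq> c" "a \<noteq> c"
    by (auto simp: card_3_iff)
  then have "\<exists>a\<in>A. \<exists>b\<in>A. \<exists>c\<in>A. a < b \<and> b < c"
    by (metis insertCI linorder_neq_iff)
  then obtain a b c where abc: "a \<in> h ` ball x r" "b \<in> h ` ball x r" "c \<in> h ` ball x r" "a < b" "b < c"
    using A(1) by (meson subsetD)
  then obtain y where y: "y \<in> ball x r" "b = h y" by blast
  have "connected (ball x r - {y})"
    by (rule connected_open_delete) auto
  then have "connected (h ` (ball x r - {y}))"
    using conth r(2) by (meson Diff_subset connected_continuous_image continuous_on_subset order_trans)
  moreover have "a \<in> h ` (ball x r - {y})" "c \<in> h ` (ball x r - {y})"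
    using abc y by auto
  ultimately have "b \<in> h ` (ball x r - {y})"
    using abc(4,5) connectedD_interval[of "h ` (ball x r - {y})" a c b] by simp
  then show False
    using inj y by (auto dest: inj_onD)
qed

lemma interior_Union_closed_empty:
  assumes "finite \<C>" "\<And>C. C \<in> \<C> \<Longrightarrow> closed C \<and> interior C = {}"
  shows "interior (\<Union>\<C>) = {}"
  using assms
proof (induction \<C>)
  case (insert C \<C>)
  then show ?case
    using interior_closed_Un_empty_interior[of C "\<Union>\<C>"] by simp
qed simp

text \<open>Unifies the inside and the outside of a Jordan curve.\<close>

definition jordan_domain :: "complex set \<Rightarrow> complex set \<Rightarrow> bool" where
  "jordan_domain J D \<longleftrightarrow> D \<noteq> {} \<and> open D \<and> connected D \<and> D \<inter> J = {} \<and> frontier D = J"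

definition jordan_curve :: "complex set \<Rightarrow> bool" where
  "jordan_curve J \<longleftrightarrow> (\<exists>c. simple_path c \<and> pathfinish c = pathstart c \<and> path_image c = J)"

lemma jordan_curve_sides:
  assumes "jordan_curve J"
  shows "jordan_domain J (inside J)" "jordan_domain J (outside J)"
    "inside J \<inter> outside J = {}" "inside J \<union> outside J = - J"
proof -
  from assms obtain c where c: "simple_path c" "pathfinish c = pathstart c" "path_image c = J"
    by (auto simp: jordan_curve_def)
  note * = Jordan_inside_outside[OF c(1,2), unfolded c(3)]
  show "jordan_domain J (inside J)" "jordan_domain J (outside J)"
    "inside J \<inter> outside J = {}" "inside J \<union> outside J = - J"
    using * by (auto simp: jordan_domain_def)
qed

lemma jordan_curve_compact: "jordan_curve J \<Longrightarrow> compact J"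
  by (auto simp: jordan_curve_def compact_simple_path_image)

lemma connected_subset_or_disjoint:
  assumes "connected D" "D \<inter> frontier A = {}"
  shows "D \<subseteq> A \<or> D \<inter> A = {}"
  using connected_Int_frontier[OF assms(1), of A] assms(2) by blast

text \<open>Two Jordan domains of the same curve that meet are equal, since each is connected and
  misses the frontier of the other; and \<open>D\<close> must meet the inside or the
  outside.\<close>

lemma jordan_domain_unique:
  assumes "jordan_curve J" "jordan_domain J D"
  shows "D = inside J \<or> D = outside J"
proof -
  have eq: "D = A" if "jordan_domain J A" "D \<inter> A \<noteq> {}" for A
  proof -
    have "D \<subseteq> A"
      using connected_subset_or_disjoint[of D A] that assms(2) by (auto simp: jordan_domain_def)
    moreover have "A \<subseteq> D"
      using connected_subset_or_disjoint[of A D] that assms(2) by (auto simp: jordan_domain_def)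
    ultimately show ?thesis by blast
  qed
  have "D \<subseteq> inside J \<union> outside J" "D \<noteq> {}"
    using assms jordan_curve_sides(4)[OF assms(1)] by (auto simp: jordan_domain_def)
  then have "D \<inter> inside J \<noteq> {} \<or> D \<inter> outside J \<noteq> {}"
    by blast
  then show ?thesis
    using eq jordan_curve_sides(1,2)[OF assms(1)] by blast
qed

lemma jordan_domain_other_side:
  assumes "jordan_curve J" "jordan_domain J D"
  shows "jordan_domain J (- (J \<union> D))"
proof -
  have "- (J \<union> inside J) = outside J" "- (J \<union> outside J) = inside J"
    using jordan_curve_sides(3,4)[OF assms(1)] by blast+
  then show ?thesis
    using jordan_domain_unique[OF assms] jordan_curve_sides(1,2)[OF assms(1)] by auto
qed

lemma jordan_curve_join:
  assumes "arc g" "arc h" "pathstart g = a" "pathfinish g = b" "pathstart h = a" "pathfinish h = b"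
    and "path_image g \<inter> path_image h \<subseteq> {a, b}"
  shows "jordan_curve (path_image g \<union> path_image h)"
proof -
  have "simple_path (g +++ reversepath h)"
    using assms by (intro simple_path_join_loop) (auto simp: arc_reversepath)
  moreover have "path_image (g +++ reversepath h) = path_image g \<union> path_image h"
    using assms by (subst path_image_join) auto
  ultimately show ?thesis
    using assms by (auto simp: jordan_curve_def intro!: exI[of _ "g +++ reversepath h"])
qed

section \<open>Euler's inequality for plane graphs\<close>

locale plane_drawing =
  fixes G :: plane_graph
  assumes plane: "is_plane_graph G"
begin

abbreviation "V \<equiv> verts G"
abbreviation "E \<equiv> edges G"
abbreviation "cv \<equiv> curve G"

lemma finV: "finite V"
  using plane by (simp add: is_plane_graph_def simple_graph_def)

lemma edgeE:
  assumes "e \<in> E"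
  obtains u v where "u \<in> V" "v \<in> V" "u \<noteq> v" "e = {u, v}"
  using plane assms by (force simp: is_plane_graph_def simple_graph_def)

lemma edge_subset: "e \<in> E \<Longrightarrow> e \<subseteq> V"
  by (erule edgeE) auto

lemma finE: "finite E"
  using edge_subset finV by (meson Pow_iff finite_Pow_iff finite_subset subsetI)

lemma arc_from:
  assumes "{a, b} \<in> E"
  obtains g where "arc g" "path_image g = cv {a, b}" "pathstart g = a" "pathfinish g = b"
proof -
  obtain g where g: "arc g" "path_image g = cv {a, b}" "{a, b} = {pathstart g, pathfinish g}"
    using plane assms by (fastforce simp: is_plane_graph_def)
  from g(3) consider "pathstart g = a" "pathfinish g = b" | "pathstart g = b" "pathfinish g = a"
    by (auto simp: doubleton_eq_iff)
  then show ?thesis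
  proof cases
    case 1 then show ?thesis using g that by blast
  next
    case 2 then show ?thesis
      using g that[of "reversepath g"] by (simp add: arc_reversepath)
  qed
qed

lemma curve_arc:
  assumes "e \<in> E"
  obtains g where "arc g" "path_image g = cv e" "e = {pathstart g, pathfinish g}"
  using plane assms by (fastforce simp: is_plane_graph_def)

lemma edge_subset_curve: "e \<in> E \<Longrightarrow> e \<subseteq> cv e"
  by (metis curve_arc empty_subsetI insert_subset pathfinish_in_path_image pathstart_in_path_image)

lemma compact_curve: "e \<in> E \<Longrightarrow> compact (cv e)"
  by (metis curve_arc compact_arc_image)

lemma connected_curve: "e \<in> E \<Longrightarrow> connected (cv e)"
  by (metis curve_arc connected_arc_image)

lemma interior_curve: "e \<in> E \<Longrightarrow> interior (cv e) = {}"
  by (metis curve_arc interior_arc_image_empty)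

lemma curve_Int_V: "e \<in> E \<Longrightarrow> cv e \<inter> V = e"
proof -
  assume e: "e \<in> E"
  then have "(cv e - e) \<inter> V = {}"
    using plane by (simp add: is_plane_graph_def)
  then show ?thesis
    using edge_subset[OF e] edge_subset_curve[OF e] by blast
qed

lemma curve_Int_curve: "e \<in> E \<Longrightarrow> e' \<in> E \<Longrightarrow> e \<noteq> e' \<Longrightarrow> cv e \<inter> cv e' \<subseteq> e \<inter> e'"
proof -
  assume e: "e \<in> E" "e' \<in> E" "e \<noteq> e'"
  then have "(cv e - e) \<inter> cv e' = {}" "(cv e' - e') \<inter> cv e = {}"
    using plane unfolding is_plane_graph_def by metis+
  then show ?thesis
    by blast
qed

lemma obtain_inner_point:
  assumes "e \<in> E"
  obtains p where "p \<in> cv e" "p \<notin> V"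
proof -
  obtain g where g: "arc g" "path_image g = cv e"
    by (metis curve_arc assms)
  then have "infinite (cv e)"
    using arc_imp_inj_on[OF g(1)] finite_imageD[of g "{0..1}"] infinite_Icc[of 0 "1::real"]
    by (auto simp: path_image_def)
  then have "\<exists>p. p \<in> cv e - V"
    using finV by (metis Diff_infinite_finite ex_in_conv finite.emptyI)
  then show ?thesis using that by blast
qed

section \<open>Faces of partial drawings\<close>

definition draw :: "complex set set \<Rightarrow> complex set" where
  "draw A = V \<union> \<Union> (cv ` A)"

lemma faces_draw: "faces G = components (- draw E)"
  by (simp add: faces_def draw_def)

lemma draw_parts:
  assumes "A \<subseteq> E" "C \<in> insert V (cv ` A)"
  shows "closed C" "interior C = {}"
proof -
  have "interior V = {}"
    using finV by (metis finite_imp_not_open finite_subset interior_subset open_interior)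
  then show "closed C" "interior C = {}"
    using assms finV compact_curve interior_curve
    by (auto intro: finite_imp_closed compact_imp_closed)
qed

lemma finite_draw_parts: "A \<subseteq> E \<Longrightarrow> finite (insert V (cv ` A))"
  using finE finite_subset by blast

lemma draw_Union: "draw A = \<Union> (insert V (cv ` A))"
  by (simp add: draw_def)

lemma closed_draw: "A \<subseteq> E \<Longrightarrow> closed (draw A)"
  unfolding draw_Union using finite_draw_parts draw_parts by (intro closed_Union) auto

lemma interior_draw: "A \<subseteq> E \<Longrightarrow> interior (draw A) = {}"
  unfolding draw_Union using finite_draw_parts draw_parts
  by (intro interior_Union_closed_empty) auto

lemma draw_mono: "A \<subseteq> B \<Longrightarrow> draw A \<subseteq> draw B"
  by (auto simp: draw_def)

lemma face_props:
  assumes "A \<subseteq> E" "F \<in> components (- draw A)"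
  shows "open F" "connected F" "F \<noteq> {}" "F \<inter> draw A = {}"
  using assms closed_draw[OF assms(1)] open_components[of "- draw A" F]
  by (auto simp: in_components_connected in_components_nonempty open_Compl
      dest: in_components_subset)


lemma curve_Int_draw:
  assumes "A \<subseteq> E" "e \<in> E" "e \<notin> A"
  shows "cv e \<inter> draw A \<subseteq> e"
proof -
  have "cv e \<inter> cv e' \<subseteq> e" if "e' \<in> A" for e'
    using curve_Int_curve[of e e'] assms that by auto
  then show ?thesis
    using curve_Int_V[OF assms(2)] by (auto simp: draw_def)
qed

lemma draw_insert: "draw (insert e A) = cv e \<union> draw A"
  by (auto simp: draw_def)

text \<open>Sending a face to the face of the smaller drawing around it is onto: faces are open and
  \<open>draw B\<close> has empty interior, so the added curves cannot swallow a face of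
  \<open>draw A\<close>.\<close>

lemma face_coarsening:
  assumes "A \<subseteq> B" "B \<subseteq> E"
  obtains g where "components (- draw A) = g ` components (- draw B)"
    "\<And>F. F \<in> components (- draw B) \<Longrightarrow> F \<subseteq> g F"
proof -
  have "\<exists>C. C \<in> components (- draw A) \<and> F \<subseteq> C" if "F \<in> components (- draw B)" for F
    using exists_component_superset[of F "- draw A"] face_props[OF assms(2) that] draw_mono[OF assms(1)]
    by blast
  then obtain g where g: "\<And>F. F \<in> components (- draw B) \<Longrightarrow> g F \<in> components (- draw A) \<and> F \<subseteq> g F"
    by metis
  have "C \<in> g ` components (- draw B)" if C: "C \<in> components (- draw A)" for C
  proof -
    have "open C" "C \<noteq> {}"
      using face_props[of A C] C assms by auto
    then have "\<not> C \<subseteq> draw B"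
      using interior_draw[OF assms(2)] by (metis bot.extremum_uniqueI interior_maximal)
    then obtain x where x: "x \<in> C" "x \<notin> draw B" by blast
    then obtain F where F: "F \<in> components (- draw B)" "x \<in> F"
      by (metis ComplI UnionE Union_components)
    then have "g F = C"
      using g[OF F(1)] C x components_eq by blast
    then show ?thesis using F by blast
  qed
  then have "components (- draw A) = g ` components (- draw B)"
    using g by blast
  then show ?thesis using that g by blast
qed

definition num_faces :: "complex set set \<Rightarrow> nat" where
  "num_faces A = card (components (- draw A))"

text \<open>For \<open>A \<subseteq> E\<close> every path component of the drawing contains a
  vertex, so all of them are counted, and their finiteness is that of \<open>V\<close>.\<close>

definition num_comps :: "complex set set \<Rightarrow> nat" where
  "num_comps A = card (path_component_set (draw A) ` V)"

lemma V_subset_draw: "V \<subseteq> draw A"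
  by (simp add: draw_def)

lemma path_component_set_eq_iff:
  assumes "x \<in> S" "y \<in> S"
  shows "path_component_set S x = path_component_set S y \<longleftrightarrow> path_component S x y"
  using assms by (metis mem_Collect_eq path_component_eq path_component_refl path_component_sym)

text \<open>Enlarging the drawing only merges components: \<open>h\<close> sends each old component
  to the new one around it, and it is not injective once two old components are joined.\<close>

lemma num_comps_mono:
  assumes "A \<subseteq> B"
  shows "num_comps B \<le> num_comps A"
    and "u \<in> V \<Longrightarrow> v \<in> V \<Longrightarrow> path_component (draw B) u v \<Longrightarrow> \<not> path_component (draw A) u v \<Longrightarrow>
      num_comps B < num_comps A"
proof -
  let ?f = "path_component_set (draw A)" and ?g = "path_component_set (draw B)"
  define h where "h C = ?g (SOME x. x \<in> V \<and> ?f x = C)" for C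
  have h: "?g x = h (?f x)" if "x \<in> V" for x
  proof -
    define y where "y = (SOME y. y \<in> V \<and> ?f y = ?f x)"
    have "y \<in> V \<and> ?f y = ?f x"
      unfolding y_def by (rule someI[of _ x]) (use that in simp)
    then have "path_component (draw A) y x" "y \<in> V"
      using V_subset_draw[of A] that path_component_set_eq_iff[of y "draw A" x] by auto
    then have "path_component (draw B) y x"
      using path_component_of_subset[OF draw_mono[OF assms]] by blast
    then have "?g y = ?g x"
      by (simp add: path_component_eq)
    then show ?thesis by (simp add: h_def y_def)
  qed
  then have img: "?g ` V = h ` ?f ` V"
    by (auto simp: image_image)
  then show le: "num_comps B \<le> num_comps A"
    unfolding num_comps_def using finV by (simp add: card_image_le)
  assume uv: "u \<in> V" "v \<in> V" "path_component (draw B) u v" "\<not> path_component (draw A) u v"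
  then have "?f u \<noteq> ?f v" "h (?f u) = h (?f v)"
    using V_subset_draw path_component_set_eq_iff[of u _ v] h by (metis subsetD)+
  then have "\<not> inj_on h (?f ` V)"
    using uv by (auto dest: inj_onD)
  then have "card (h ` ?f ` V) < card (?f ` V)"
    using finV by (metis card_image_le eq_card_imp_inj_on finite_imageI le_neq_implies_less)
  then show "num_comps B < num_comps A"
    unfolding num_comps_def img .
qed

text \<open>A new edge either joins two components of the drawing, or closes a Jordan curve and
  then has different faces on its two sides.\<close>

lemma euler_step:
  assumes A: "A \<subseteq> E" and e: "e \<in> E" "e \<notin> A"
    and fin: "finite (components (- draw (insert e A)))"
  shows "num_comps (insert e A) + num_faces A + 1 \<le> num_comps A + num_faces (insert e A)"
proof -
  let ?B = "insert e A"
  have B: "?B \<subseteq> E" using A e by simp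
  obtain u v where uv: "u \<in> V" "v \<in> V" "u \<noteq> v" "e = {u, v}"
    using edgeE[OF e(1)] by metis
  obtain g1 where g1: "arc g1" "path_image g1 = cv e" "pathstart g1 = u" "pathfinish g1 = v"
    using arc_from[of u v] e uv by metis
  obtain g where g: "components (- draw A) = g ` components (- draw ?B)"
    "\<And>F. F \<in> components (- draw ?B) \<Longrightarrow> F \<subseteq> g F"
    using face_coarsening[OF subset_insertI B] by metis
  have le: "num_faces A \<le> num_faces ?B"
    unfolding num_faces_def g(1) using fin by (rule card_image_le)
  show ?thesis
  proof (cases "path_component (draw A) u v")
    case False
    have "path_component (draw ?B) u v"
      unfolding path_component_def using g1 arc_imp_path draw_insert by blast
    then show ?thesis
      using num_comps_mono(2)[OF subset_insertI uv(1,2) _ False] le by fastforce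
  next
    case True
    then obtain q where q: "path q" "path_image q \<subseteq> draw A" "pathstart q = u" "pathfinish q = v"
      by (auto simp: path_component_def)
    then obtain g2 where g2: "arc g2" "path_image g2 \<subseteq> draw A" "pathstart g2 = u" "pathfinish g2 = v"
      using path_contains_arc[OF q(1,3,4) uv(3)] by (metis subset_trans)
    \<comment> \<open>The new curve meets the old drawing only in its ends, so together with an arc
      of the old drawing it forms a Jordan curve.\<close>
    define J where "J = path_image g1 \<union> path_image g2"
    have J: "jordan_curve J"
      unfolding J_def using g1 g2 curve_Int_draw[OF A e] uv
      by (intro jordan_curve_join[of _ _ u v]) auto
    have JB: "J \<subseteq> draw ?B" "cv e \<subseteq> J"
      using g1 g2 draw_insert by (auto simp: J_def)
    note sides = jordan_curve_sides[OF J]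
    \<comment> \<open>A small ball around an inner point of the new curve avoids the old drawing and
      so lies in one old face, but it meets both sides of \<open>J\<close> and hence two different
      new faces.\<close>
    obtain p where p: "p \<in> cv e" "p \<notin> V"
      using obtain_inner_point[OF e(1)] by blast
    then have "p \<notin> draw A"
      using curve_Int_draw[OF A e] uv by auto
    then obtain r where r: "r > 0" "ball p r \<subseteq> - draw A"
      using closed_draw[OF A] by (meson ComplI open_Compl open_contains_ball)
    have pc: "p \<in> closure (inside J)" "p \<in> closure (outside J)"
      using sides(1,2) p JB by (auto simp: jordan_domain_def frontier_def)
    obtain x where x: "x \<in> inside J" "x \<in> ball p r"
      using pc(1) r(1) closure_approachable by (metis dist_commute mem_ball)
    obtain y where y: "y \<in> outside J" "y \<in> ball p r"
      using pc(2) r(1) closure_approachable by (metis dist_commute mem_ball)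
    have xy: "x \<notin> draw ?B" "y \<notin> draw ?B"
    proof -
      have "x \<notin> J" "y \<notin> J" using x y sides(4) by blast+
      then show "x \<notin> draw ?B" "y \<notin> draw ?B"
        using x y JB(2) r(2) unfolding draw_insert by blast+
    qed
    obtain Fx where Fx: "Fx \<in> components (- draw ?B)" "x \<in> Fx"
      using xy(1) by (metis ComplI UnionE Union_components)
    obtain Fy where Fy: "Fy \<in> components (- draw ?B)" "y \<in> Fy"
      using xy(2) by (metis ComplI UnionE Union_components)
    have "Fx \<subseteq> inside J \<or> Fx \<inter> inside J = {}"
      using face_props[OF B Fx(1)] JB sides(1)
      by (intro connected_subset_or_disjoint) (auto simp: jordan_domain_def)
    then have "Fx \<noteq> Fy"
      using Fx Fy x y sides(3) by blast
    have ball: "ball p r \<subseteq> g F" if "F \<in> components (- draw ?B)" "z \<in> F" "z \<in> ball p r" for F z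
    proof (rule components_maximal)
      show "g F \<in> components (- draw A)" unfolding g(1) using that(1) by simp
      show "g F \<inter> ball p r \<noteq> {}" using that(2,3) g(2)[OF that(1)] by blast
    qed (use r(2) in simp_all)
    have "x \<in> g Fx" "x \<in> g Fy"
      using ball[OF Fx x(2)] ball[OF Fy y(2)] x(2) by auto
    moreover have "g Fx \<in> components (- draw A)" "g Fy \<in> components (- draw A)"
      unfolding g(1) using Fx(1) Fy(1) by simp_all
    ultimately have "g Fx = g Fy"
      using components_eq by blast
    then have "\<not> inj_on g (components (- draw ?B))"
      using Fx(1) Fy(1) \<open>Fx \<noteq> Fy\<close> by (auto dest: inj_onD)
    then have "num_faces A < num_faces ?B"
      unfolding num_faces_def g(1) using fin
      by (metis card_image_le eq_card_imp_inj_on le_neq_implies_less)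
    then show ?thesis
      using num_comps_mono(1)[OF subset_insertI, of e A] by linarith
  qed
qed

text \<open>The drawing without edges has at most \<open>card V\<close> components and at least one
  face, and \<open>euler_step\<close> preserves the inequality. Finiteness of the set of faces
  passes from the larger drawing to the smaller one by \<open>face_coarsening\<close>.\<close>

lemma euler_inequality:
  assumes "A \<subseteq> E" "finite (components (- draw A))"
  shows "card A + num_comps A + 1 \<le> card V + num_faces A"
proof -
  have "finite A" using assms(1) finE finite_subset by blast
  then show ?thesis using assms
  proof (induction A)
    case empty
    have "draw {} \<noteq> UNIV"
      using interior_draw[of "{}"] interior_UNIV by force
    then have "components (- draw {}) \<noteq> {}"
      by (metis Compl_empty_eq components_eq_empty double_compl)
    then have "num_faces {} \<ge> 1"
      using empty by (simp add: num_faces_def Suc_leI card_gt_0_iff)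
    moreover have "num_comps {} \<le> card V"
      unfolding num_comps_def using finV by (rule card_image_le)
    ultimately show ?case by simp
  next
    case (insert e A)
    then have "components (- draw A) = {} \<or> finite (components (- draw A))"
      using face_coarsening[of A "insert e A"] by (metis finite_imageI subset_insertI)
    then show ?case
      using insert euler_step[of A e] by auto
  qed
qed

end

section \<open>Faces of plane triangulations\<close>

lemma closure_Int_open_nbhd:
  assumes "p \<in> closure U" "open B" "p \<in> B"
  shows "p \<in> closure (U \<inter> B)"
  using assms open_Int_closure_subset[of B U] by (auto simp: Int_commute)

lemma closure_finite_Union:
  "finite \<C> \<Longrightarrow> closure (\<Union> \<C>) = \<Union> (closure ` \<C>)"
  by (induction \<C> rule: finite_induct) auto

lemma doubletons_of_triple:
  assumes "u \<noteq> v" "v \<noteq> w" "u \<noteq> w"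
  shows "{e. e \<subseteq> {u, v, w} \<and> card e = 2} = {{u, v}, {u, w}, {v, w}}"
  using assms by (auto simp: card_2_iff doubleton_eq_iff)

text \<open>A triangle alone has two faces with the same three corners; \<open>four_verts\<close>
  excludes this, so that faces can be identified with their corner triples.\<close>

locale triangulated_drawing = plane_drawing +
  assumes triangulation: "plane_triangulation G" and four_verts: "card V \<ge> 4"
begin

abbreviation "\<F> \<equiv> faces G"

definition tri :: "complex set \<Rightarrow> complex set" where
  "tri F = frontier F \<inter> V"

lemma face_open: "F \<in> \<F> \<Longrightarrow> open F"
  and face_connected: "F \<in> \<F> \<Longrightarrow> connected F"
  and face_nonempty: "F \<in> \<F> \<Longrightarrow> F \<noteq> {}"
  and face_Int_draw: "F \<in> \<F> \<Longrightarrow> F \<inter> draw E = {}"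
  using face_props[of E F] by (auto simp: faces_draw)

lemma face_disjoint: "F \<in> \<F> \<Longrightarrow> F' \<in> \<F> \<Longrightarrow> F \<noteq> F' \<Longrightarrow> F \<inter> F' = {}"
  unfolding faces_draw by (metis components_nonoverlap)

lemma Union_faces: "\<Union> \<F> = - draw E"
  by (simp add: faces_draw Union_components)

lemma curve_subset_draw: "e \<in> E \<Longrightarrow> cv e \<subseteq> draw E"
  by (auto simp: draw_def)

lemma face_triangle:
  assumes "F \<in> \<F>"
  obtains u v w where "u \<noteq> v" "v \<noteq> w" "u \<noteq> w" "{u, v} \<in> E" "{v, w} \<in> E" "{u, w} \<in> E"
    "frontier F = cv {u, v} \<union> cv {v, w} \<union> cv {u, w}" "tri F = {u, v, w}"
proof -
  from triangulation assms obtain u v w where *: "u \<noteq> v" "v \<noteq> w" "u \<noteq> w"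
    "{u, v} \<in> E" "{v, w} \<in> E" "{u, w} \<in> E"
    "frontier F = cv {u, v} \<union> cv {v, w} \<union> cv {u, w}"
    unfolding plane_triangulation_def by metis
  have "tri F = {u, v} \<union> {v, w} \<union> {u, w}"
    unfolding tri_def *(7) Int_Un_distrib2 using curve_Int_V * by simp
  then show ?thesis using that * by auto
qed

lemma tri_card: "F \<in> \<F> \<Longrightarrow> card (tri F) = 3"
  by (erule face_triangle) auto

lemma tri_edges:
  assumes "F \<in> \<F>" "e \<subseteq> tri F" "card e = 2"
  shows "e \<in> E"
proof -
  obtain u v w where *: "u \<noteq> v" "v \<noteq> w" "u \<noteq> w" "{u, v} \<in> E" "{v, w} \<in> E" "{u, w} \<in> E"
    "tri F = {u, v, w}"
    using face_triangle[OF assms(1)] by metis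
  have "e \<in> {e. e \<subseteq> {u, v, w} \<and> card e = 2}"
    using *(7) assms(2,3) by simp
  then show ?thesis
    unfolding doubletons_of_triple[OF *(1-3)] using *(4-6) by auto
qed

lemma frontier_face:
  assumes "F \<in> \<F>"
  shows "frontier F = (\<Union>e\<in>{e. e \<subseteq> tri F \<and> card e = 2}. cv e)"
proof -
  obtain u v w where *: "u \<noteq> v" "v \<noteq> w" "u \<noteq> w"
    "frontier F = cv {u, v} \<union> cv {v, w} \<union> cv {u, w}" "tri F = {u, v, w}"
    using face_triangle[OF assms] by metis
  show ?thesis
    unfolding *(5) doubletons_of_triple[OF *(1-3)] *(4) by auto
qed

lemma tri_edge_cases:
  assumes "F \<in> \<F>" "{u, v} \<subseteq> tri F" "u \<noteq> v"
  obtains w where "tri F = {u, v, w}" "u \<noteq> w" "v \<noteq> w" "{u, w} \<in> E" "{w, v} \<in> E" "{u, v} \<in> E"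
    "frontier F = cv {u, v} \<union> (cv {u, w} \<union> cv {w, v})"
proof -
  obtain w where w: "tri F = {u, v, w}" "u \<noteq> w" "v \<noteq> w"
  proof -
    obtain a b c where *: "a \<noteq> b" "b \<noteq> c" "a \<noteq> c" "tri F = {a, b, c}"
      using face_triangle[OF assms(1)] by metis
    have "card (tri F - {u, v}) = 1"
      using assms * by (subst card_Diff_subset) auto
    then obtain w where "tri F - {u, v} = {w}"
      by (auto simp: card_1_singleton_iff)
    then show ?thesis using that[of w] assms by blast
  qed
  have "{u, w} \<in> E" "{w, v} \<in> E" "{u, v} \<in> E"
    using tri_edges[OF assms(1)] w assms(3) by auto
  moreover have "frontier F = cv {u, v} \<union> (cv {u, w} \<union> cv {w, v})"
    unfolding frontier_face[OF assms(1)] w(1)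
    using doubletons_of_triple[of u v w] w assms(3) by (auto simp: insert_commute)
  ultimately show ?thesis using that w by blast
qed

lemma arc_two_edges:
  assumes "{u, w} \<in> E" "{w, v} \<in> E" "u \<noteq> v"
  obtains h where "arc h" "path_image h = cv {u, w} \<union> cv {w, v}" "pathstart h = u" "pathfinish h = v"
proof -
  obtain g1 where g1: "arc g1" "path_image g1 = cv {u, w}" "pathstart g1 = u" "pathfinish g1 = w"
    using arc_from[OF assms(1)] by metis
  obtain g2 where g2: "arc g2" "path_image g2 = cv {w, v}" "pathstart g2 = w" "pathfinish g2 = v"
    using arc_from[OF assms(2)] by metis
  have "cv {u, w} \<inter> cv {w, v} \<subseteq> {u, w} \<inter> {w, v}"
    using assms by (intro curve_Int_curve) (auto simp: doubleton_eq_iff)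
  then have "arc (g1 +++ g2)"
    using g1 g2 assms(3) by (intro arc_join) auto
  then show ?thesis
    using that[of "g1 +++ g2"] g1 g2 by (simp add: path_image_join)
qed

lemma jordan_face:
  assumes "F \<in> \<F>"
  shows "jordan_curve (frontier F)" "jordan_domain (frontier F) F"
proof -
  obtain u v w where *: "u \<noteq> v" "v \<noteq> w" "u \<noteq> w" "{u, v} \<in> E" "{v, w} \<in> E" "{u, w} \<in> E"
    "frontier F = cv {u, v} \<union> cv {v, w} \<union> cv {u, w}"
    using face_triangle[OF assms] by metis
  obtain g where g: "arc g" "path_image g = cv {u, v}" "pathstart g = u" "pathfinish g = v"
    using arc_from[OF *(4)] by metis
  have wv: "{w, v} \<in> E" using * by (simp add: insert_commute)
  obtain h where h: "arc h" "path_image h = cv {u, w} \<union> cv {w, v}" "pathstart h = u" "pathfinish h = v"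
    using arc_two_edges[OF *(6) wv *(1)] by metis
  have "cv {u, v} \<inter> cv {u, w} \<subseteq> {u, v} \<inter> {u, w}" "cv {u, v} \<inter> cv {w, v} \<subseteq> {u, v} \<inter> {w, v}"
    using * wv by (intro curve_Int_curve; auto simp: doubleton_eq_iff)+
  then have "path_image g \<inter> path_image h \<subseteq> {u, v}"
    unfolding g h by blast
  then have "jordan_curve (path_image g \<union> path_image h)"
    using g h by (intro jordan_curve_join) auto
  then show "jordan_curve (frontier F)"
    using *(7) g(2) h(2) by (simp add: insert_commute Un_ac)
  have "frontier F \<subseteq> draw E"
    using *(4-7) curve_subset_draw by auto
  then have "F \<inter> frontier F = {}"
    using face_Int_draw[OF assms] by blast
  then show "jordan_domain (frontier F) F"
    using face_open face_connected face_nonempty assms by (simp add: jordan_domain_def)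
qed

text \<open>A face is the inside or the outside of the union of the three curves of its triangle,
  and only finitely many vertex sets can be that triangle. This supplies the finiteness that Euler's
  inequality asks for.\<close>

lemma finite_faces: "finite \<F>"
proof -
  let ?J = "\<lambda>t. \<Union>e\<in>{e. e \<subseteq> t \<and> card e = 2}. cv e"
  have "\<F> \<subseteq> inside ` ?J ` Pow V \<union> outside ` ?J ` Pow V"
  proof
    fix F assume F: "F \<in> \<F>"
    have "tri F \<in> Pow V" by (auto simp: tri_def)
    then have J: "frontier F \<in> ?J ` Pow V"
      using frontier_face[OF F] by blast
    have "F = inside (frontier F) \<or> F = outside (frontier F)"
      using jordan_domain_unique jordan_face[OF F] by blast
    then show "F \<in> inside ` ?J ` Pow V \<union> outside ` ?J ` Pow V"
      using J by blast
  qed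
  then show ?thesis
    by (rule finite_subset) (simp add: finV)
qed

text \<open>Two faces on the same triangle would be the two sides of one Jordan curve and fill its
  complement, so all vertices would lie on the triangle.\<close>

lemma inj_tri: "inj_on tri \<F>"
proof (rule inj_onI, rule ccontr)
  fix F F' assume F: "F \<in> \<F>" "F' \<in> \<F>" "tri F = tri F'" "F \<noteq> F'"
  then have eq: "frontier F' = frontier F"
    by (simp add: frontier_face)
  have "F = inside (frontier F) \<or> F = outside (frontier F)"
    "F' = inside (frontier F) \<or> F' = outside (frontier F)"
    using jordan_domain_unique[OF jordan_face[OF F(1)]]
      jordan_domain_unique[OF jordan_face[OF F(2)]] unfolding eq by blast+
  then have "F \<union> F' = inside (frontier F) \<union> outside (frontier F)"
    using F(4) by (metis Un_commute)
  then have "F \<union> F' = - frontier F"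
    by simp
  moreover have "V \<inter> F = {}" "V \<inter> F' = {}"
    using face_Int_draw F V_subset_draw by blast+
  ultimately have "V \<subseteq> tri F"
    unfolding tri_def by blast
  then have "card V \<le> card (tri F)"
    by (intro card_mono) (auto simp: tri_def finV)
  then show False using tri_card[OF F(1)] four_verts by simp
qed

section \<open>Every edge lies on exactly two faces\<close>

lemma edge_of_face:
  assumes "F \<in> \<F>" "e \<in> E" "p \<in> cv e" "p \<notin> V" "p \<in> closure F"
  shows "e \<subseteq> tri F"
proof -
  have "p \<in> frontier F"
    using assms face_Int_draw[OF assms(1)] curve_subset_draw[OF assms(2)] face_open[OF assms(1)]
    by (auto simp: frontier_def interior_open)
  then obtain e' where e': "e' \<subseteq> tri F" "card e' = 2" "p \<in> cv e'"
    using frontier_face[OF assms(1)] by auto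
  then have "e' = e"
    using curve_Int_curve[of e e'] tri_edges[OF assms(1), of e'] assms edge_subset by blast
  then show ?thesis using e' by simp
qed

lemma curve_subset_frontier:
  assumes "F \<in> \<F>" "e \<in> E" "e \<subseteq> tri F"
  shows "cv e \<subseteq> frontier F"
proof -
  have "card e = 2" using assms(2) by (elim edgeE) simp
  then show ?thesis unfolding frontier_face[OF assms(1)] using assms by blast
qed

text \<open>Near \<open>p\<close> the drawing consists of \<open>cv e\<close> alone, so there
  \<open>U\<close> is covered by the finitely many faces, and one of them accumulates at
  \<open>p\<close>. The set \<open>U\<close> selects the side from which \<open>p\<close> is
  approached.\<close>

lemma face_near_edge:
  assumes "e \<in> E" "p \<in> cv e" "p \<notin> V" "p \<in> closure U" "U \<inter> cv e = {}"
  obtains F where "F \<in> \<F>" "p \<in> closure F" "F \<inter> U \<noteq> {}"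
proof -
  let ?B = "- draw (E - {e})"
  have "p \<notin> draw (E - {e})"
    using curve_Int_draw[of "E - {e}" e] assms edge_subset by auto
  then have p: "p \<in> closure (U \<inter> ?B)"
    using closed_draw[of "E - {e}"] assms by (intro closure_Int_open_nbhd) auto
  have "draw E = cv e \<union> draw (E - {e})"
    using draw_insert[of e "E - {e}"] assms(1) by (simp add: insert_absorb)
  then have "U \<inter> ?B \<subseteq> \<Union> \<F>"
    unfolding Union_faces using assms(5) by blast
  then have "U \<inter> ?B = \<Union> ((\<lambda>F. F \<inter> (U \<inter> ?B)) ` \<F>)"
    by auto
  then have "closure (U \<inter> ?B) = \<Union> (closure ` (\<lambda>F. F \<inter> (U \<inter> ?B)) ` \<F>)"
    using closure_finite_Union[of "(\<lambda>F. F \<inter> (U \<inter> ?B)) ` \<F>"] finite_faces by simp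
  then obtain F where F: "F \<in> \<F>" "p \<in> closure (F \<inter> (U \<inter> ?B))"
    using p by auto
  then have "p \<in> closure F"
    using closure_mono[of "F \<inter> (U \<inter> ?B)" F] by auto
  moreover have "F \<inter> U \<noteq> {}"
    using F(2) by (metis Int_assoc closure_empty empty_iff inf_bot_left)
  ultimately show ?thesis using that F(1) by blast
qed

lemma edge_two_faces:
  assumes "e \<in> E"
  obtains F1 F2 where "F1 \<in> \<F>" "F2 \<in> \<F>" "F1 \<noteq> F2" "e \<subseteq> tri F1" "e \<subseteq> tri F2"
proof -
  obtain p where p: "p \<in> cv e" "p \<notin> V"
    using obtain_inner_point[OF assms] by blast
  have "p \<in> closure (- cv e)"
    using interior_curve[OF assms] by (simp add: closure_complement)
  then obtain F1 where F1: "F1 \<in> \<F>" "p \<in> closure F1"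
    using face_near_edge[OF assms p, of "- cv e"] by auto
  then have e1: "e \<subseteq> tri F1"
    using edge_of_face assms p by blast
  \<comment> \<open>The second face is found by approaching \<open>p\<close> from the side of the
    triangle opposite to \<open>F1\<close>.\<close>
  let ?O = "- (frontier F1 \<union> F1)"
  have O: "jordan_domain (frontier F1) ?O"
    using jordan_domain_other_side jordan_face[OF F1(1)] by blast
  have sub: "cv e \<subseteq> frontier F1"
    using curve_subset_frontier[OF F1(1) assms e1] .
  have "p \<in> closure ?O"
    using O p sub by (auto simp: jordan_domain_def frontier_def)
  then obtain F2 where F2: "F2 \<in> \<F>" "p \<in> closure F2" "F2 \<inter> ?O \<noteq> {}"
    using face_near_edge[OF assms p, of ?O] sub by auto
  then have "F1 \<noteq> F2" by blast
  then show ?thesis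
    using that[of F1 F2] F1 F2 e1 edge_of_face[OF F2(1) assms p F2(2)] by blast
qed


text \<open>Of three faces on \<open>e\<close>, two bound a quadrilateral whose one side contains \<open>e\<close>. By
  Janiszewski's theorem a point of the third face on that side could be joined to the other side
  off both triangles.\<close>

lemma edge_at_most_two_faces:
  assumes e: "e \<in> E" and F: "F1 \<in> \<F>" "F2 \<in> \<F>" "F3 \<in> \<F>"
    and eF: "e \<subseteq> tri F1" "e \<subseteq> tri F2" "e \<subseteq> tri F3"
    and ne: "F1 \<noteq> F2" "F1 \<noteq> F3" "F2 \<noteq> F3"
  shows False
proof -
  obtain u v where uv: "u \<in> V" "v \<in> V" "u \<noteq> v" "e = {u, v}"
    using edgeE[OF e] by metis
  obtain p where p: "p \<in> cv e" "p \<notin> V"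
    using obtain_inner_point[OF e] by blast
  obtain g where g: "arc g" "path_image g = cv e" "pathstart g = u" "pathfinish g = v"
    using arc_from[of u v] e uv by metis
  obtain w1 where w1: "tri F1 = {u, v, w1}" "u \<noteq> w1" "v \<noteq> w1" "{u, w1} \<in> E" "{w1, v} \<in> E"
    "frontier F1 = cv e \<union> (cv {u, w1} \<union> cv {w1, v})"
    using tri_edge_cases[OF F(1), of u v] eF(1) uv by metis
  obtain w2 where w2: "tri F2 = {u, v, w2}" "u \<noteq> w2" "v \<noteq> w2" "{u, w2} \<in> E" "{w2, v} \<in> E"
    "frontier F2 = cv e \<union> (cv {u, w2} \<union> cv {w2, v})"
    using tri_edge_cases[OF F(2), of u v] eF(2) uv by metis
  have "tri F1 \<noteq> tri F2"
    using inj_tri F ne by (auto dest: inj_onD)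
  then have w12: "w1 \<noteq> w2" using w1 w2 by auto
  obtain h1 where h1: "arc h1" "path_image h1 = cv {u, w1} \<union> cv {w1, v}" "pathstart h1 = u" "pathfinish h1 = v"
    using arc_two_edges[OF w1(4,5) uv(3)] by metis
  obtain h2 where h2: "arc h2" "path_image h2 = cv {u, w2} \<union> cv {w2, v}" "pathstart h2 = u" "pathfinish h2 = v"
    using arc_two_edges[OF w2(4,5) uv(3)] by metis
  \<comment> \<open>\<open>J\<close> is the quadrilateral \<open>u\<close>, \<open>w1\<close>,
    \<open>v\<close>, \<open>w2\<close>, with \<open>e\<close> as a diagonal.\<close>
  define J where "J = path_image h1 \<union> path_image h2"
  have cross: "cv a \<inter> cv b \<subseteq> {u, v}" if "a \<in> E" "b \<in> E" "a \<noteq> b" "a \<inter> b \<subseteq> {u, v}" for a b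
    using curve_Int_curve[OF that(1-3)] that(4) by blast
  have "cv {u, w1} \<inter> cv {u, w2} \<subseteq> {u, v}" "cv {u, w1} \<inter> cv {w2, v} \<subseteq> {u, v}"
    "cv {w1, v} \<inter> cv {u, w2} \<subseteq> {u, v}" "cv {w1, v} \<inter> cv {w2, v} \<subseteq> {u, v}"
    by (rule cross; use w1 w2 w12 uv in \<open>auto simp: doubleton_eq_iff\<close>)+
  then have h12: "path_image h1 \<inter> path_image h2 \<subseteq> {u, v}"
    unfolding h1 h2 by blast
  then have J: "jordan_curve J"
    unfolding J_def using h1 h2 by (intro jordan_curve_join) auto
  have "cv e \<inter> cv {u, w1} \<subseteq> {u, v}" "cv e \<inter> cv {w1, v} \<subseteq> {u, v}"
    "cv e \<inter> cv {u, w2} \<subseteq> {u, v}" "cv e \<inter> cv {w2, v} \<subseteq> {u, v}"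
    by (rule cross; use e w1 w2 w12 uv in \<open>auto simp: doubleton_eq_iff\<close>)+
  then have eJ: "cv e \<inter> J \<subseteq> {u, v}"
    unfolding J_def h1 h2 by blast
  have Jfr: "frontier F1 \<union> frontier F2 = cv e \<union> J"
    unfolding J_def h1 h2 w1 w2 by blast
  have uvJ: "u \<in> J" "v \<in> J" "w2 \<in> J"
    using h1 h2 edge_subset_curve[OF w2(4)] pathstart_in_path_image pathfinish_in_path_image
    unfolding J_def by (metis UnCI insert_subset)+
  have pJ: "p \<notin> J" using eJ p uv by blast
  \<comment> \<open>\<open>D\<close> is the side of \<open>J\<close> that contains \<open>e\<close>
    without its ends, be it the inside or the outside.\<close>
  obtain D D' where D: "jordan_domain J D" "jordan_domain J D'" "D \<inter> D' = {}" "p \<in> D"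
  proof -
    have "p \<in> inside J \<or> p \<in> outside J"
      using jordan_curve_sides(4)[OF J] pJ by blast
    then show ?thesis
      using that jordan_curve_sides(1,2,3)[OF J] by (metis Int_commute)
  qed
  have "connected (cv e - {u, v})"
    using connected_simple_path_endless[OF arc_imp_simple_path[OF g(1)]] g by simp
  then have "cv e - {u, v} \<subseteq> D \<or> (cv e - {u, v}) \<inter> D = {}"
    using D(1) eJ by (intro connected_subset_or_disjoint) (auto simp: jordan_domain_def)
  moreover have "p \<in> cv e - {u, v}" using p uv by auto
  ultimately have "cv e - {u, v} \<subseteq> D" using D(4) by blast
  then have eD': "cv e \<inter> D' = {}"
    using D(2,3) uvJ unfolding jordan_domain_def by blast
  have D'J: "D' \<inter> (frontier F1 \<union> frontier F2) = {}"
    unfolding Jfr using eD' D(2) unfolding jordan_domain_def by blast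
  \<comment> \<open>A face covering \<open>D'\<close> would have all of \<open>J\<close> in its
    closure, in particular the corner that belongs to the other triangle only.\<close>
  have off: "D' \<inter> F = {}" if "F \<in> \<F>" "D' \<inter> frontier F = {}" "w \<in> J" "w \<in> V" "w \<notin> tri F" for F w
  proof (rule ccontr)
    assume "D' \<inter> F \<noteq> {}"
    then have "D' \<subseteq> F"
      using connected_subset_or_disjoint[of D' F] that(2) D(2) by (auto simp: jordan_domain_def)
    then have "closure D' \<subseteq> closure F"
      by (rule closure_mono)
    moreover have "J \<subseteq> closure D'"
      using D(2) by (auto simp: jordan_domain_def frontier_def)
    ultimately have "w \<in> closure F" using that by blast
    then have "w \<in> F \<or> w \<in> frontier F"
      by (metis Un_iff closure_Un_frontier)
    then show False
      using that face_Int_draw[of F] V_subset_draw unfolding tri_def by blast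
  qed
  have w1J: "w1 \<in> J"
    using edge_subset_curve[OF w1(4)] unfolding J_def h1 by blast
  have wV: "w1 \<in> V" "w2 \<in> V"
    using edge_subset w1(4) w2(4) by auto
  have "D' \<inter> F1 = {}"
    using off[of F1 w2] F(1) D'J uvJ(3) wV w1(1) w12 w2(2,3) by auto
  moreover have "D' \<inter> F2 = {}"
    using off[of F2 w1] F(2) D'J w1J wV w2(1) w12 w1(2,3) by auto
  ultimately have D'O: "D' \<subseteq> - (frontier F1 \<union> F1)" "D' \<subseteq> - (frontier F2 \<union> F2)"
    using D'J by blast+
  have "p \<in> frontier F3"
    using curve_subset_frontier[OF F(3) e eF(3)] p by blast
  then have "p \<in> closure F3"
    by (simp add: frontier_def)
  then have "p \<in> closure (F3 \<inter> D)"
    using D(1,4) by (intro closure_Int_open_nbhd) (auto simp: jordan_domain_def)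
  then obtain z where z: "z \<in> F3" "z \<in> D"
    by (metis IntE closure_eq_empty ex_in_conv)
  have fr: "frontier F1 \<subseteq> draw E" "frontier F2 \<subseteq> draw E"
    unfolding w1(6) w2(6) using curve_subset_draw e w1 w2 by auto
  then have zO: "z \<in> - (frontier F1 \<union> F1)" "z \<in> - (frontier F2 \<union> F2)"
    using z(1) face_Int_draw[OF F(3)] face_disjoint[OF F(1,3) ne(2)] face_disjoint[OF F(2,3) ne(3)]
    by blast+
  obtain q where q: "q \<in> D'"
    using D(2) by (auto simp: jordan_domain_def)
  have conn: "connected_component (- frontier F) z q"
    if "F \<in> \<F>" "z \<in> - (frontier F \<union> F)" "D' \<subseteq> - (frontier F \<union> F)" for F
    using jordan_domain_other_side[OF jordan_face[OF that(1)]] that q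
    by (auto simp: connected_component_def jordan_domain_def intro!: exI[of _ "- (frontier F \<union> F)"])
  \<comment> \<open>Janiszewski's theorem asks for a connected intersection of the two closed sets;
    here it is a single arc. The resulting connected set \<open>C\<close> avoids \<open>J\<close>
    but runs from \<open>D\<close> to \<open>D'\<close>.\<close>
  have "frontier F1 \<inter> frontier F2 = cv e"
    unfolding w1(6) w2(6) using h12 h1(2) h2(2) edge_subset_curve[OF e] uv by blast
  then have "connected_component (- (frontier F1 \<union> frontier F2)) z q"
    using jordan_curve_compact[OF jordan_face(1)] F connected_curve[OF e]
      conn[OF F(1) zO(1) D'O(1)] conn[OF F(2) zO(2) D'O(2)]
    by (intro Janiszewski) (auto intro: compact_imp_closed)
  then obtain C where C: "connected C" "C \<subseteq> - (frontier F1 \<union> frontier F2)" "z \<in> C" "q \<in> C"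
    by (auto simp: connected_component_def)
  then have "C \<subseteq> D \<or> C \<inter> D = {}"
    using D(1) Jfr by (intro connected_subset_or_disjoint) (auto simp: jordan_domain_def)
  then show False
    using C z q D(3) by blast
qed

lemma closure_Union_faces: "\<Union> (closure ` \<F>) = UNIV"
proof -
  have "closure (\<Union> \<F>) = UNIV"
    unfolding Union_faces by (simp add: closure_complement interior_draw)
  then show ?thesis
    using closure_finite_Union[OF finite_faces] by simp
qed

text \<open>The plane minus the finitely many vertices is connected and covered by the closures of
  the faces.\<close>

lemma dual_connected:
  assumes "R \<subseteq> \<F>" "R \<noteq> {}"
    and closed: "\<And>F F' e. F \<in> R \<Longrightarrow> F' \<in> \<F> \<Longrightarrow> e \<in> E \<Longrightarrow> e \<subseteq> tri F \<Longrightarrow> e \<subseteq> tri F' \<Longrightarrow> F' \<in> R"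
  shows "R = \<F>"
proof (rule ccontr)
  assume "R \<noteq> \<F>"
  let ?A = "\<Union> (closure ` R)" and ?B = "\<Union> (closure ` (\<F> - R))"
  have fin: "finite R" "finite (\<F> - R)"
    using assms(1) finite_faces finite_subset by auto
  have meets: "\<Union> (closure ` S) \<inter> - V \<noteq> {}" if S: "S \<subseteq> \<F>" "S \<noteq> {}" for S
  proof -
    obtain F where F: "F \<in> S" "F \<in> \<F>" using S by blast
    then obtain x where "x \<in> F" using face_nonempty by blast
    then have "x \<in> closure F" "x \<notin> V"
      using closure_subset face_Int_draw[OF F(2)] V_subset_draw by blast+
    then show ?thesis using F(1) by blast
  qed
  have "connected (- V)"
    using finV by (intro path_connected_imp_connected path_connected_complement_countable)
      (auto intro: countable_finite)
  moreover have "closed ?A" "closed ?B"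
    using fin by (auto intro!: closed_Union)
  moreover have "- V \<subseteq> ?A \<union> ?B"
    using closure_Union_faces assms(1) by blast
  moreover have "?A \<inter> - V \<noteq> {}" "?B \<inter> - V \<noteq> {}"
    using meets[of R] meets[of "\<F> - R"] assms(1,2) \<open>R \<noteq> \<F>\<close> by blast+
  ultimately have "?A \<inter> ?B \<inter> - V \<noteq> {}"
    using connected_closedD[of "- V" ?A ?B] by blast
  then obtain p F F' where p: "p \<notin> V" "F \<in> R" "p \<in> closure F" "F' \<in> \<F>" "F' \<notin> R" "p \<in> closure F'"
    by blast
  then have F: "F \<in> \<F>" "F \<inter> F' = {}" "F' \<inter> F = {}"
    using face_disjoint[of F F'] face_disjoint[of F' F] assms(1) by auto
  \<comment> \<open>An open face containing \<open>p\<close> would meet both \<open>F\<close> and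
    \<open>F'\<close>. Hence \<open>p\<close> lies on a curve, and its edge is shared by
    \<open>F\<close> and \<open>F'\<close>.\<close>
  have no: "p \<notin> H" if "H \<in> \<F>" for H
  proof
    assume "p \<in> H"
    then have "H \<inter> F \<noteq> {}" "H \<inter> F' \<noteq> {}"
      using p open_Int_closure_eq_empty[OF face_open[OF that]] by blast+
    then show False
      using face_disjoint[OF that] F p by metis
  qed
  then have "p \<in> draw E"
    using Union_faces by blast
  then obtain e where e: "e \<in> E" "p \<in> cv e"
    using p(1) by (auto simp: draw_def)
  then have "e \<subseteq> tri F" "e \<subseteq> tri F'"
    using edge_of_face F p by blast+
  then show False
    using closed[OF p(2,4) e(1)] p(5) by blast
qed

end

section \<open>Cycles in connected regions of triangles\<close>

text \<open>A cycle for \<open>k \<ge> 3\<close> only: for \<open>k = 2\<close> a single edge would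
  do.\<close>

definition has_cycle :: "'a set set \<Rightarrow> nat \<Rightarrow> bool" where
  "has_cycle A k \<longleftrightarrow> (\<exists>xs. length xs = k \<and> distinct xs \<and>
     successively (\<lambda>a b. {a, b} \<in> A) xs \<and> {last xs, hd xs} \<in> A)"

text \<open>The ends form an unordered pair, so one listed path serves both orientations.\<close>

definition spans :: "'a set set \<Rightarrow> 'a set \<Rightarrow> nat \<Rightarrow> 'a set \<Rightarrow> bool" where
  "spans A W k e \<longleftrightarrow> (\<exists>xs. length xs = k \<and> xs \<noteq> [] \<and> distinct xs \<and> set xs \<subseteq> W \<and>
     successively (\<lambda>a b. {a, b} \<in> A) xs \<and> e = {hd xs, last xs})"

lemma has_cycle_mono: "has_cycle A k \<Longrightarrow> A \<subseteq> B \<Longrightarrow> has_cycle B k"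
  unfolding has_cycle_def by (metis (no_types, lifting) subsetD successively_mono)

lemma spans_close:
  assumes "spans A W k {u, v}" "x \<notin> W" "{u, x} \<in> A" "{v, x} \<in> A"
  shows "has_cycle A (Suc k)"
proof -
  obtain xs where xs: "length xs = k" "xs \<noteq> []" "distinct xs" "set xs \<subseteq> W"
    "successively (\<lambda>a b. {a, b} \<in> A) xs" "{u, v} = {hd xs, last xs}"
    using assms(1) by (auto simp: spans_def)
  have "{hd xs, x} \<in> A" "{last xs, x} \<in> A"
    using xs(6) assms(3,4) by (auto simp: doubleton_eq_iff)
  moreover have "x \<notin> set xs" using xs(4) assms(2) by blast
  ultimately show ?thesis
    unfolding has_cycle_def using xs
    by (intro exI[of _ "x # xs"]) (auto simp: successively_Cons insert_commute)
qed

section \<open>Triangle complexes and their growth\<close>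

definition skel :: "'a set set \<Rightarrow> 'a set set" where
  "skel R = {e. card e = 2 \<and> (\<exists>t\<in>R. e \<subseteq> t)}"

text \<open>Connectivity of the dual graph, in which triangles with a common side are adjacent. The
  form with closed subsets is the one that \<open>grow\<close> applies to the triangles inside
  \<open>W\<close>.\<close>

definition strongly_connected :: "'a set set \<Rightarrow> bool" where
  "strongly_connected R \<longleftrightarrow> (\<forall>S\<subseteq>R. S \<noteq> {} \<longrightarrow>
     (\<forall>t\<in>S. \<forall>t'\<in>R. card (t \<inter> t') = 2 \<longrightarrow> t' \<in> S) \<longrightarrow> S = R)"

text \<open>Because of \<open>thin\<close>, a side that already lies in two known triangles cannot
  carry a new vertex; the growth arguments discard such sides as used up.\<close>

locale triangle_complex =
  fixes R :: "'a set set"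
  assumes card3: "t \<in> R \<Longrightarrow> card t = 3"
    and thin: "{u, v, a} \<in> R \<Longrightarrow> {u, v, b} \<in> R \<Longrightarrow> {u, v, c} \<in> R \<Longrightarrow>
      a \<noteq> b \<Longrightarrow> b \<noteq> c \<Longrightarrow> a \<noteq> c \<Longrightarrow> False"
    and strong: "strongly_connected R"
begin

abbreviation "A \<equiv> skel R"

lemma edge_iff: "{u, v} \<in> A \<longleftrightarrow> u \<noteq> v \<and> (\<exists>t\<in>R. u \<in> t \<and> v \<in> t)"
  by (auto simp: skel_def card_2_iff doubleton_eq_iff)

lemma triple_distinct: "{a, b, c} \<in> R \<Longrightarrow> a \<noteq> b \<and> b \<noteq> c \<and> a \<noteq> c"
  using card3[of "{a, b, c}"] by (auto simp: card_insert_if split: if_splits)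

lemma triple_edges:
  assumes "{a, b, c} \<in> R"
  shows "{a, b} \<in> A" "{b, a} \<in> A" "{a, c} \<in> A" "{c, a} \<in> A" "{b, c} \<in> A" "{c, b} \<in> A"
proof -
  have "{x, y} \<in> A" if "x \<noteq> y" "x \<in> {a, b, c}" "y \<in> {a, b, c}" for x y
    unfolding edge_iff using that assms by (intro conjI bexI[of _ "{a, b, c}"])
  then show "{a, b} \<in> A" "{b, a} \<in> A" "{a, c} \<in> A" "{c, a} \<in> A" "{b, c} \<in> A" "{c, b} \<in> A"
    using triple_distinct[OF assms] by auto
qed

text \<open>If no triangle could be added, the triangles inside \<open>W\<close> would be all of
  \<open>R\<close> by strong connectivity, although \<open>W\<close> is too small to cover
  \<open>\<Union> R\<close>. The corner \<open>y\<close> records that the side \<open>{u, v}\<close>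
  belongs to a triangle inside \<open>W\<close>.\<close>

lemma grow:
  assumes "t \<in> R" "t \<subseteq> W" "finite W" "card W < card (\<Union> R)"
  obtains u v y x where "u \<in> W" "v \<in> W" "y \<in> W" "x \<notin> W" "{u, v, y} \<in> R" "{u, v, x} \<in> R"
proof -
  let ?S = "{t \<in> R. t \<subseteq> W}"
  have "\<not> \<Union> R \<subseteq> W"
    using assms(4) card_mono[OF assms(3), of "\<Union> R"] by linarith
  then have "?S \<noteq> R" by blast
  moreover have "?S \<subseteq> R" "?S \<noteq> {}" using assms by auto
  ultimately obtain s s' where s: "s \<in> ?S" "s' \<in> R" "card (s \<inter> s') = 2" "s' \<notin> ?S"
    using strong[unfolded strongly_connected_def, THEN spec, of ?S] by blast
  obtain u v where uv: "s \<inter> s' = {u, v}" "u \<noteq> v"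
    using s(3) by (auto simp: card_2_iff)
  have third: "\<exists>w. r = {u, v, w}" if "r \<in> R" "{u, v} \<subseteq> r" for r
  proof -
    have "card (r - {u, v}) = 1"
      using that card3[OF that(1)] uv(2) by (subst card_Diff_subset) auto
    then obtain w where "r - {u, v} = {w}" by (auto simp: card_1_singleton_iff)
    then show ?thesis using that by (intro exI[of _ w]) blast
  qed
  obtain y x where "s = {u, v, y}" "s' = {u, v, x}"
    using third[of s] third[of s'] s uv by blast
  then show ?thesis using that[of u v y x] s by auto
qed

lemma close:
  assumes "spans A W k {u, v}" "x \<notin> W" "{u, v, x} \<in> R"
  shows "has_cycle A (Suc k)"
  using spans_close[OF assms(1,2)] triple_edges[OF assms(3)] by blast

section \<open>Small configurations of triangles\<close>

definition fan3 where
  "fan3 c w1 w2 w3 w4 \<longleftrightarrow> distinct [c, w1, w2, w3, w4] \<and>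
     {c, w1, w2} \<in> R \<and> {c, w2, w3} \<in> R \<and> {c, w3, w4} \<in> R"

text \<open>Four triangles glued in tree form have as dual tree a path, turning twice the same way
  (\<open>fan4\<close>) or alternately (\<open>strip\<close>), or a claw
  (\<open>triforce\<close>).\<close>

definition fan4 where
  "fan4 c w1 w2 w3 w4 w5 \<longleftrightarrow> distinct [c, w1, w2, w3, w4, w5] \<and>
     {c, w1, w2} \<in> R \<and> {c, w2, w3} \<in> R \<and> {c, w3, w4} \<in> R \<and> {c, w4, w5} \<in> R"

definition strip where
  "strip p1 p2 p3 p4 p5 p6 \<longleftrightarrow> distinct [p1, p2, p3, p4, p5, p6] \<and>
     {p1, p2, p3} \<in> R \<and> {p2, p3, p4} \<in> R \<and> {p3, p4, p5} \<in> R \<and> {p4, p5, p6} \<in> R"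

definition triforce where
  "triforce a b c x y z \<longleftrightarrow> distinct [a, b, c, x, y, z] \<and>
     {a, b, c} \<in> R \<and> {a, b, x} \<in> R \<and> {b, c, y} \<in> R \<and> {a, c, z} \<in> R"

text \<open>The only obstruction on seven vertices: if there are no further edges, deleting \<open>a\<close>, \<open>b\<close>, \<open>c\<close>
  leaves four isolated vertices, so there is no 7-cycle.\<close>

definition star where
  "star a b c p q r z \<longleftrightarrow> distinct [a, b, c, p, q, r, z] \<and>
     {{a, b}, {b, c}, {a, c}, {p, a}, {p, b}, {p, c}, {q, a}, {q, b}, {r, a}, {r, c}, {z, b}, {z, c}} \<subseteq> A \<and>
     (\<forall>x. x \<notin> {a, b, c, p, q, r, z} \<longrightarrow> {a, b, x} \<notin> R \<and> {a, c, x} \<notin> R \<and> {b, c, x} \<notin> R)"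

text \<open>Reduces the case analyses below to checking lists of explicit paths.\<close>

lemma spans_all:
  assumes "\<forall>p\<in>set L. distinct p \<and> set p \<subseteq> W \<and> successively (\<lambda>a b. {a, b} \<in> A) p \<and> length p = k \<and> p \<noteq> []"
  shows "\<forall>p\<in>set L. spans A W k {hd p, last p}"
  using assms unfolding spans_def by blast

text \<open>A fifth vertex is attached to two triangles \<open>{a, b, c}\<close> and
  \<open>{a, b, d}\<close>. The side \<open>{a, b}\<close> is used up, the four outer sides give a
  fan directly, and for \<open>{c, d}\<close> the inner triangle through this pair gives a fan
  around \<open>d\<close>.\<close>

lemma exists_fan3:
  assumes "card (\<Union> R) \<ge> 5"
  obtains c w1 w2 w3 w4 where "fan3 c w1 w2 w3 w4"
proof -
  have "R \<noteq> {}" using assms by auto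
  then obtain t where t: "t \<in> R" by blast
  have ct: "finite t" "card t < card (\<Union> R)"
    using card3[OF t] assms by (auto intro: card_ge_0_finite)
  obtain a b c d where abc: "a \<in> t" "b \<in> t" "c \<in> t" "d \<notin> t" "{a, b, c} \<in> R" "{a, b, d} \<in> R"
    using grow[OF t order_refl ct] by metis
  have dist: "distinct [a, b, c, d]"
    using triple_distinct[OF abc(5)] triple_distinct[OF abc(6)] abc(1-4) by auto
  let ?W = "{a, b, c, d}"
  have W: "card ?W < card (\<Union> R)" "finite ?W"
    using assms dist by auto
  obtain u v y x where g: "u \<in> ?W" "v \<in> ?W" "y \<in> ?W" "x \<notin> ?W" "{u, v, y} \<in> R" "{u, v, x} \<in> R"
    by (rule grow[OF abc(5) _ W(2,1)]) auto
  have uvy: "u \<noteq> v" "v \<noteq> y" "u \<noteq> y"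
    using triple_distinct[OF g(5)] by auto
  have "{a, b, x} \<notin> R"
    using thin[OF abc(5,6), of x] dist g(4) by auto
  moreover have "fan3 b d a c x" if "{b, c, x} \<in> R"
    using that abc dist g(4) by (auto simp: fan3_def insert_commute)
  moreover have "fan3 a d b c x" if "{a, c, x} \<in> R"
    using that abc dist g(4) by (auto simp: fan3_def insert_commute)
  moreover have "fan3 b c a d x" if "{b, d, x} \<in> R"
    using that abc dist g(4) by (auto simp: fan3_def insert_commute)
  moreover have "fan3 a c b d x" if "{a, d, x} \<in> R"
    using that abc dist g(4) by (auto simp: fan3_def insert_commute)
  moreover have "fan3 d b a c x" if "{c, d, x} \<in> R" "{a, c, d} \<in> R"
    using that abc dist g(4) by (auto simp: fan3_def insert_commute)
  moreover have "fan3 d a b c x" if "{c, d, x} \<in> R" "{b, c, d} \<in> R"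
    using that abc dist g(4) by (auto simp: fan3_def insert_commute)
  ultimately have "\<exists>c w1 w2 w3 w4. fan3 c w1 w2 w3 w4"
    using g uvy by (elim insertE emptyE) (simp_all add: insert_commute, blast+)
  then show ?thesis using that by blast
qed

text \<open>In a fan on five vertices, Hamilton paths join all pairs except the inner spokes
  \<open>{c, w2}\<close> and \<open>{c, w3}\<close>, and these are used up. So a sixth vertex closes
  a 6-cycle wherever it is attached.\<close>

lemma six_cycle:
  assumes "card (\<Union> R) \<ge> 6"
  shows "has_cycle A 6"
proof -
  have "card (\<Union> R) \<ge> 5" using assms by simp
  then obtain c w1 w2 w3 w4 where f: "fan3 c w1 w2 w3 w4"
    by (rule exists_fan3)
  then have T: "{c, w1, w2} \<in> R" "{c, w2, w3} \<in> R" "{c, w3, w4} \<in> R"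
    and dist: "distinct [c, w1, w2, w3, w4]"
    by (auto simp: fan3_def)
  let ?W = "{c, w1, w2, w3, w4}"
  have W: "card ?W < card (\<Union> R)" "finite ?W"
    using assms dist by auto
  obtain u v y x where g: "u \<in> ?W" "v \<in> ?W" "y \<in> ?W" "x \<notin> ?W" "{u, v, y} \<in> R" "{u, v, x} \<in> R"
    by (rule grow[OF T(1) _ W(2,1)]) auto
  note edges = triple_edges[OF T(1)] triple_edges[OF T(2)] triple_edges[OF T(3)]
  have pts: "\<forall>p\<in>set [[c, w4, w3, w2, w1],
      [c, w1, w2, w3, w4],
      [w1, c, w4, w3, w2],
      [w1, w2, c, w4, w3],
      [w1, c, w2, w3, w4],
      [w2, w1, c, w4, w3],
      [w2, w1, c, w3, w4],
      [w3, w2, w1, c, w4]].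
      spans A ?W 5 {hd p, last p}"
    by (rule spans_all) (use dist edges in auto)
  have "{c, w2, x} \<notin> R" "{c, w3, x} \<notin> R"
    using thin[of c w2 w1 w3 x] thin[of c w3 w2 w4 x] T dist g(4) by (auto simp: insert_commute)
  then have "spans A ?W 5 {u, v}"
    using g(1,2,6) triple_distinct[OF g(5)] pts
    by (elim insertE emptyE) (simp_all add: insert_commute)
  from close[OF this g(4,6)] show ?thesis by simp
qed

text \<open>A sixth vertex is attached to a fan of three triangles. On an outer side it gives one of
  the shapes at once; on a chord \<open>{w1, w3}\<close>, \<open>{w2, w4}\<close> or
  \<open>{w1, w4}\<close> the inner triangle through the chord replaces one triangle of the
  fan.\<close>

lemma exists_tree4:
  assumes "card (\<Union> R) \<ge> 6"
  shows "(\<exists>c w1 w2 w3 w4 w5. fan4 c w1 w2 w3 w4 w5) \<or> (\<exists>p1 p2 p3 p4 p5 p6. strip p1 p2 p3 p4 p5 p6) \<or>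
    (\<exists>a b c x y z. triforce a b c x y z)" (is ?tree)
proof -
  have "card (\<Union> R) \<ge> 5" using assms by simp
  then obtain c w1 w2 w3 w4 where f: "fan3 c w1 w2 w3 w4"
    by (rule exists_fan3)
  then have T: "{c, w1, w2} \<in> R" "{c, w2, w3} \<in> R" "{c, w3, w4} \<in> R"
    and dist: "distinct [c, w1, w2, w3, w4]"
    by (auto simp: fan3_def)
  let ?W = "{c, w1, w2, w3, w4}"
  have W: "card ?W < card (\<Union> R)" "finite ?W"
    using assms dist by auto
  obtain u v y x where g: "u \<in> ?W" "v \<in> ?W" "y \<in> ?W" "x \<notin> ?W" "{u, v, y} \<in> R" "{u, v, x} \<in> R"
    by (rule grow[OF T(1) _ W(2,1)]) auto
  have uvy: "u \<noteq> v" "v \<noteq> y" "u \<noteq> y"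
    using triple_distinct[OF g(5)] by auto
  have fan: ?tree if "fan4 o' v1 v2 v3 v4 v5" for o' v1 v2 v3 v4 v5
    using that by blast
  have strip: ?tree if "strip p1 p2 p3 p4 p5 p6" for p1 p2 p3 p4 p5 p6
    using that by blast
  have sat: "{c, w2, z} \<notin> R" "{c, w3, z'} \<notin> R" if "z \<notin> {c, w1, w2, w3}" "z' \<notin> {c, w2, w3, w4}" for z z'
    using thin[of c w2 w1 w3 z] thin[of c w3 w2 w4 z'] T dist that by (auto simp: insert_commute)
  \<comment> \<open>The last two facts exclude \<open>c\<close> as third corner over the chords
    \<open>{w1, w3}\<close> and \<open>{w2, w4}\<close>: an inner spoke would get a third
    triangle.\<close>
  have no: "{c, w2, x} \<notin> R" "{c, w3, x} \<notin> R" "{c, w1, w3} \<notin> R" "{c, w2, w4} \<notin> R"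
    using sat[of x x] sat[of w4 w1] g(4) dist by (auto simp: insert_commute)
  note defs = fan4_def strip_def triforce_def insert_commute
  have ?tree if "{c, w1, x} \<in> R"
    by (rule fan[of c x w1 w2 w3 w4]) (use that T dist g(4) in \<open>auto simp: defs\<close>)
  moreover have ?tree if "{c, w4, x} \<in> R"
    by (rule fan[of c w1 w2 w3 w4 x]) (use that T dist g(4) in \<open>auto simp: defs\<close>)
  moreover have ?tree if "{w1, w2, x} \<in> R"
    by (rule strip[of x w1 w2 c w3 w4]) (use that T dist g(4) in \<open>auto simp: defs\<close>)
  moreover have ?tree if "{w3, w4, x} \<in> R"
    by (rule strip[of x w4 w3 c w2 w1]) (use that T dist g(4) in \<open>auto simp: defs\<close>)
  moreover have ?tree if "{w2, w3, x} \<in> R"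
  proof -
    have "triforce c w2 w3 w1 x w4"
      using that T dist g(4) by (auto simp: defs)
    then show ?thesis by blast
  qed
  moreover have ?tree if "{w1, w4, x} \<in> R" "{c, w1, w4} \<in> R"
    by (rule strip[of x w1 w4 c w3 w2]) (use that T dist g(4) in \<open>auto simp: defs\<close>)
  moreover have ?tree if "{w1, w4, x} \<in> R" "{w1, w2, w4} \<in> R"
    by (rule strip[of w3 c w2 w1 w4 x]) (use that T dist g(4) in \<open>auto simp: defs\<close>)
  moreover have ?tree if "{w1, w4, x} \<in> R" "{w1, w3, w4} \<in> R"
    by (rule strip[of w2 c w3 w4 w1 x]) (use that T dist g(4) in \<open>auto simp: defs\<close>)
  moreover have ?tree if "{w1, w3, x} \<in> R" "{w1, w2, w3} \<in> R"
    by (rule fan[of w3 w4 c w2 w1 x]) (use that T dist g(4) in \<open>auto simp: defs\<close>)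
  moreover have ?tree if "{w1, w3, x} \<in> R" "{w1, w3, w4} \<in> R"
    by (rule fan[of w3 x w1 w4 c w2]) (use that T dist g(4) in \<open>auto simp: defs\<close>)
  moreover have ?tree if "{w2, w4, x} \<in> R" "{w2, w3, w4} \<in> R"
    by (rule fan[of w2 w1 c w3 w4 x]) (use that T dist g(4) in \<open>auto simp: defs\<close>)
  moreover have ?tree if "{w2, w4, x} \<in> R" "{w1, w2, w4} \<in> R"
    by (rule fan[of w2 x w4 w1 c w3]) (use that T dist g(4) in \<open>auto simp: defs\<close>)
  ultimately show ?tree
    using g uvy no by (elim insertE emptyE) (simp_all only: insert_commute simp_thms)
qed

text \<open>The twelve listed Hamilton paths join all pairs of the six vertices except the sides
  \<open>{p2, p3}\<close>, \<open>{p3, p4}\<close> and \<open>{p4, p5}\<close>, which are used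
  up.\<close>

lemma strip_seven_cycle:
  assumes "strip p1 p2 p3 p4 p5 p6" "card (\<Union> R) \<ge> 7"
  shows "has_cycle A 7"
proof -
  have T: "{p1, p2, p3} \<in> R" "{p2, p3, p4} \<in> R" "{p3, p4, p5} \<in> R" "{p4, p5, p6} \<in> R"
    and dist: "distinct [p1, p2, p3, p4, p5, p6]"
    using assms(1) by (auto simp: strip_def)
  let ?W = "{p1, p2, p3, p4, p5, p6}"
  have W: "card ?W < card (\<Union> R)" "finite ?W"
    using assms(2) dist by auto
  obtain u v y x where g: "u \<in> ?W" "v \<in> ?W" "y \<in> ?W" "x \<notin> ?W" "{u, v, y} \<in> R" "{u, v, x} \<in> R"
    by (rule grow[OF T(1) _ W(2,1)]) auto
  note edges = triple_edges[OF T(1)] triple_edges[OF T(2)] triple_edges[OF T(3)] triple_edges[OF T(4)]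
  have pts: "\<forall>p\<in>set [[p1, p3, p5, p6, p4, p2],
      [p1, p2, p4, p6, p5, p3],
      [p1, p2, p3, p5, p6, p4],
      [p1, p2, p3, p4, p6, p5],
      [p1, p2, p3, p4, p5, p6],
      [p2, p1, p3, p5, p6, p4],
      [p2, p1, p3, p4, p6, p5],
      [p2, p1, p3, p4, p5, p6],
      [p3, p1, p2, p4, p6, p5],
      [p3, p1, p2, p4, p5, p6],
      [p4, p2, p1, p3, p5, p6],
      [p5, p3, p1, p2, p4, p6]].
      spans A ?W 6 {hd p, last p}"
    by (rule spans_all) (use dist edges in auto)
  have "{p2, p3, x} \<notin> R" "{p3, p4, x} \<notin> R" "{p4, p5, x} \<notin> R"
    using thin[of p2 p3 p1 p4 x] thin[of p3 p4 p2 p5 x] thin[of p4 p5 p3 p6 x] T dist g(4)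
    by (auto simp: insert_commute)
  then have "spans A ?W 6 {u, v}"
    using g(1,2,6) triple_distinct[OF g(5)] pts
    by (elim insertE emptyE) (simp_all add: insert_commute)
  from close[OF this g(4,6)] show ?thesis by simp
qed

text \<open>The three sides of the middle triangle are used up and nine pairs are joined by Hamilton
  paths of the configuration. The remaining pairs, a corner of the middle triangle and the tip
  opposite to it, need one more edge.\<close>

lemma triforce_seven_cycle:
  assumes "triforce a b c d e f" "card (\<Union> R) \<ge> 7"
  shows "has_cycle A 7"
proof -
  have T: "{a, b, c} \<in> R" "{a, b, d} \<in> R" "{b, c, e} \<in> R" "{a, c, f} \<in> R"
    and dist: "distinct [a, b, c, d, e, f]"
    using assms(1) by (auto simp: triforce_def)
  let ?W = "{a, b, c, d, e, f}"
  have W: "card ?W < card (\<Union> R)" "finite ?W"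
    using assms(2) dist by auto
  obtain u v y x where g: "u \<in> ?W" "v \<in> ?W" "y \<in> ?W" "x \<notin> ?W" "{u, v, y} \<in> R" "{u, v, x} \<in> R"
    by (rule grow[OF T(1) _ W(2,1)]) auto
  have uvy: "u \<noteq> v" "v \<noteq> y" "u \<noteq> y"
    using triple_distinct[OF g(5)] by auto
  note edges = triple_edges[OF T(1)] triple_edges[OF T(2)] triple_edges[OF T(3)] triple_edges[OF T(4)]
  have pts: "\<forall>p\<in>set [[a, f, c, e, b, d],
      [a, d, b, e, c, f],
      [b, e, c, f, a, d],
      [b, d, a, f, c, e],
      [c, f, a, d, b, e],
      [c, e, b, d, a, f],
      [d, a, f, c, b, e],
      [d, a, b, e, c, f],
      [e, b, d, a, c, f]].
      spans A ?W 6 {hd p, last p}"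
    by (rule spans_all) (use dist edges in auto)
  have no: "{a, b, s} \<notin> R" "{b, c, s'} \<notin> R" "{a, c, s''} \<notin> R"
    if "s \<notin> {a, b, c, d}" "s' \<notin> {a, b, c, e}" "s'' \<notin> {a, b, c, f}" for s s' s''
    using thin[of a b c d s] thin[of b c a e s'] thin[of a c b f s''] T dist that
    by (auto simp: insert_commute)
  have nox: "{a, b, x} \<notin> R" "{b, c, x} \<notin> R" "{a, c, x} \<notin> R"
    by (rule no(1)[of x d d] no(2)[of e x d] no(3)[of e d x]; use g(4) dist in auto)+
  have not_abc: "{a, b, e} \<notin> R" "{b, c, d} \<notin> R" "{a, c, d} \<notin> R"
    "{a, b, f} \<notin> R" "{b, c, f} \<notin> R" "{a, c, e} \<notin> R"
    by (rule no(1)[of e d d] no(2)[of e d d] no(3)[of e d d] no(1)[of f f e] no(2)[of f f e]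
        no(3)[of f f e]; use dist in auto)+
  have de: "\<forall>p\<in>set [[a, f, c, b, d, e], [c, f, a, b, e, d]]. spans A ?W 6 {hd p, last p}" if "{d, e} \<in> A" "{e, d} \<in> A"
    by (rule spans_all) (use dist edges that in auto)
  have df: "\<forall>p\<in>set [[c, e, b, a, f, d], [b, e, c, a, d, f]]. spans A ?W 6 {hd p, last p}" if "{d, f} \<in> A" "{f, d} \<in> A"
    by (rule spans_all) (use dist edges that in auto)
  have ef: "\<forall>p\<in>set [[a, d, b, c, f, e], [b, d, a, c, e, f]]. spans A ?W 6 {hd p, last p}" if "{e, f} \<in> A" "{f, e} \<in> A"
    by (rule spans_all) (use dist edges that in auto)
  \<comment> \<open>The third corner \<open>t\<close> must be another tip, because
    \<open>{a, b}\<close> and \<open>{a, c}\<close> are used up. This provides an edge between two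
    tips, and with it a Hamilton path from \<open>a\<close> to \<open>e\<close>.\<close>
  have ae: "spans A ?W 6 {a, e}" if "{a, e, t} \<in> R" "t \<in> ?W" for t
    using that not_abc triple_distinct[OF that(1)] triple_edges[OF that(1)] de ef
    by (auto simp: insert_commute)
  have bf: "spans A ?W 6 {b, f}" if "{b, f, t} \<in> R" "t \<in> ?W" for t
    using that not_abc triple_distinct[OF that(1)] triple_edges[OF that(1)] df ef
    by (auto simp: insert_commute)
  have cd: "spans A ?W 6 {c, d}" if "{c, d, t} \<in> R" "t \<in> ?W" for t
    using that not_abc triple_distinct[OF that(1)] triple_edges[OF that(1)] de df
    by (auto simp: insert_commute)
  have y: "{s, t, y} \<in> R" if "{u, v} = {s, t}" for s t
  proof -
    have "{s, t, y} = insert y {u, v}" unfolding that by auto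
    also have "\<dots> = {u, v, y}" by auto
    finally show ?thesis using g(5) by simp
  qed
  have ch: "spans A ?W 6 {u, v}" if "{u, v} \<in> {{a, e}, {b, f}, {c, d}}"
    using that ae[OF y g(3)] bf[OF y g(3)] cd[OF y g(3)] by (elim insertE emptyE) simp_all
  have "spans A ?W 6 {u, v}"
    using g(1,2,6) uvy nox pts ch
    by (elim insertE emptyE) (simp_all add: insert_commute)
  from close[OF this g(4,6)] show ?thesis by simp
qed

text \<open>Apart from the used up spokes, only \<open>{w2, w4}\<close> is not joined by a Hamilton
  path of the fan: \<open>w1\<close> and \<open>w5\<close> both force their way through
  \<open>c\<close>, and \<open>w3\<close> is missed. A vertex attached there produces the
  star.\<close>

lemma fan4_seven_cycle:
  assumes "fan4 c w1 w2 w3 w4 w5" "card (\<Union> R) \<ge> 7"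
  shows "has_cycle A 7 \<or> (\<exists>x. star c w2 w4 w3 w1 w5 x)"
proof -
  have T: "{c, w1, w2} \<in> R" "{c, w2, w3} \<in> R" "{c, w3, w4} \<in> R" "{c, w4, w5} \<in> R"
    and dist: "distinct [c, w1, w2, w3, w4, w5]"
    using assms(1) by (auto simp: fan4_def)
  let ?W = "{c, w1, w2, w3, w4, w5}"
  have W: "card ?W < card (\<Union> R)" "finite ?W"
    using assms(2) dist by auto
  obtain u v y x where g: "u \<in> ?W" "v \<in> ?W" "y \<in> ?W" "x \<notin> ?W" "{u, v, y} \<in> R" "{u, v, x} \<in> R"
    by (rule grow[OF T(1) _ W(2,1)]) auto
  note edges = triple_edges[OF T(1)] triple_edges[OF T(2)] triple_edges[OF T(3)] triple_edges[OF T(4)]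
  have pts: "\<forall>p\<in>set [[c, w5, w4, w3, w2, w1],
      [c, w1, w2, w3, w4, w5],
      [w1, c, w5, w4, w3, w2],
      [w1, w2, c, w5, w4, w3],
      [w1, w2, w3, c, w5, w4],
      [w1, c, w2, w3, w4, w5],
      [w2, w1, c, w5, w4, w3],
      [w2, w1, c, w3, w4, w5],
      [w3, w2, w1, c, w5, w4],
      [w3, w2, w1, c, w4, w5],
      [w4, w3, w2, w1, c, w5]].
      spans A ?W 6 {hd p, last p}"
    by (rule spans_all) (use dist edges in auto)
  have sat: "{c, w2, z} \<notin> R \<and> {c, w4, z} \<notin> R" if "z \<notin> ?W" for z
    using thin[of c w2 w1 w3 z] thin[of c w4 w3 w5 z] T dist that by (auto simp: insert_commute)
  have cw3: "{c, w3, x} \<notin> R"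
    using thin[of c w3 w2 w4 x] T dist g(4) by (auto simp: insert_commute)
  show ?thesis
  proof (cases "{u, v} = {w2, w4}")
    case True
    then have T': "{w2, w4, y} \<in> R" "{w2, w4, x} \<in> R"
      using g(5,6) by (auto simp: doubleton_eq_iff insert_commute)
    then have "{w2, w4, z} \<notin> R" if "z \<notin> insert x ?W" for z
      using thin[OF T', of z] g(3,4) that by auto
    moreover have "distinct [c, w2, w4, w3, w1, w5, x]"
      using dist g(4) by auto
    ultimately have "star c w2 w4 w3 w1 w5 x"
      using sat edges triple_edges[OF T'(2)] by (simp add: star_def insert_commute)
    then show ?thesis by blast
  next
    case False
    then have "spans A ?W 6 {u, v}"
      using g(1,2,6) triple_distinct[OF g(5)] pts sat[OF g(4)] cw3
      by (elim insertE emptyE) (simp_all add: insert_commute)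
    from close[OF this g(4,6)] show ?thesis by simp
  qed
qed

text \<open>Seven vertices allow a path to skip one of them: six-vertex paths join all eighteen
  pairs other than the sides of \<open>{a, b, c}\<close>, so an eighth vertex closes a 7-cycle. The
  triangle \<open>{a, b, p}\<close> is the starting point for \<open>grow\<close>.\<close>

lemma star_seven_cycle:
  assumes "star a b c p q r z" "card (\<Union> R) \<ge> 8" "{a, b, p} \<in> R"
  shows "has_cycle A 7"
proof -
  have dist: "distinct [a, b, c, p, q, r, z]" using assms(1) by (simp add: star_def)
  have edges0: "{a, b} \<in> A" "{b, c} \<in> A" "{a, c} \<in> A" "{p, a} \<in> A" "{p, b} \<in> A" "{p, c} \<in> A" "{q, a} \<in> A" "{q, b} \<in> A" "{r, a} \<in> A" "{r, c} \<in> A" "{z, b} \<in> A" "{z, c} \<in> A"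
    using assms(1) by (simp_all add: star_def)
  let ?W = "{a, b, c, p, q, r, z}"
  have W: "card ?W < card (\<Union> R)" "finite ?W"
    using assms(2) dist by auto
  obtain u v y x where g: "u \<in> ?W" "v \<in> ?W" "y \<in> ?W" "x \<notin> ?W" "{u, v, y} \<in> R" "{u, v, x} \<in> R"
    by (rule grow[OF assms(3) _ W(2,1)]) auto
  have edges1: "{b, a} \<in> A" "{c, b} \<in> A" "{c, a} \<in> A" "{a, p} \<in> A" "{b, p} \<in> A" "{c, p} \<in> A" "{a, q} \<in> A" "{b, q} \<in> A" "{a, r} \<in> A" "{c, r} \<in> A" "{b, z} \<in> A" "{c, z} \<in> A"
    using edges0 by (simp_all add: insert_commute)
  have pts: "\<forall>p\<in>set [[a, q, b, z, c, p],
      [a, p, c, z, b, q],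
      [a, p, b, z, c, r],
      [a, q, b, p, c, z],
      [b, q, a, r, c, p],
      [b, p, c, r, a, q],
      [b, q, a, p, c, r],
      [b, p, a, r, c, z],
      [c, r, a, q, b, p],
      [c, r, a, p, b, q],
      [c, p, b, q, a, r],
      [c, p, a, q, b, z],
      [p, a, c, z, b, q],
      [p, a, b, z, c, r],
      [p, a, q, b, c, z],
      [q, a, b, p, c, r],
      [q, a, b, p, c, z],
      [r, a, b, p, c, z]].
      spans A ?W 6 {hd p, last p}"
    by (rule spans_all) (use dist edges0 edges1 in auto)
  have "{a, b, x} \<notin> R" "{a, c, x} \<notin> R" "{b, c, x} \<notin> R"
    using assms(1) g(4) unfolding star_def by blast+
  then have "spans A ?W 6 {u, v}"
    using g(1,2,6) triple_distinct[OF g(5)] pts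
    by (elim insertE emptyE) (simp_all add: insert_commute)
  from close[OF this g(4,6)] show ?thesis by simp
qed

lemma seven_cycle:
  assumes "card (\<Union> R) \<ge> 8"
  shows "has_cycle A 7"
proof -
  have c7: "card (\<Union> R) \<ge> 7" "card (\<Union> R) \<ge> 6" using assms by simp_all
  have "has_cycle A 7" if fan: "fan4 c w1 w2 w3 w4 w5" for c w1 w2 w3 w4 w5
  proof -
    \<comment> \<open>In the star that arises from a fan, this is the triangle
      \<open>{a, b, p}\<close> required by \<open>star_seven_cycle\<close>.\<close>
    have "{c, w2, w3} \<in> R" using fan by (simp add: fan4_def)
    then show ?thesis
      using fan4_seven_cycle[OF fan c7(1)] star_seven_cycle assms by blast
  qed
  then show ?thesis
    using exists_tree4[OF c7(2)] strip_seven_cycle triforce_seven_cycle c7(1) by blast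
qed

end

section \<open>Counting faces around the deleted edges\<close>

lemma pairs_of_triple:
  assumes "card t = 3"
  shows "card {e. e \<subseteq> t \<and> card e = 2} = 3"
proof -
  have "finite t" using assms by (auto intro: card_ge_0_finite)
  from n_subsets[OF this, of 2] show ?thesis
    using assms by (simp add: choose_two)
qed

lemma pairs_of_triple_at:
  assumes "card t = 3" "u \<in> t"
  shows "card {e. e \<subseteq> t \<and> card e = 2 \<and> u \<in> e} = 2"
proof -
  have "card (t - {u}) = 2" using assms by simp
  then obtain v w where vw: "t - {u} = {v, w}" "v \<noteq> w"
    by (auto simp: card_2_iff)
  then have t: "t = {u, v, w}" "u \<noteq> v" "u \<noteq> w" using assms(2) by auto
  then have "{e. e \<subseteq> t \<and> card e = 2 \<and> u \<in> e} = {{u, v}, {u, w}}"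
    using vw(2) by (auto simp: card_2_iff doubleton_eq_iff)
  then show ?thesis using t vw(2) by (simp add: doubleton_eq_iff)
qed

lemma card_Int_triples:
  assumes "card s = 3" "card t = 3" "s \<noteq> t" "e \<subseteq> s" "e \<subseteq> t" "card e = 2"
  shows "s \<inter> t = e"
proof -
  have fin: "finite s" "finite t" using assms by (auto intro: card_ge_0_finite)
  have "s \<inter> t \<noteq> s" "s \<inter> t \<noteq> t"
    using assms(1-3) fin by (metis card_subset_eq inf.cobounded2 inf.cobounded1)+
  then have "card (s \<inter> t) < 3"
    using psubset_card_mono[OF fin(1), of "s \<inter> t"] assms(1) by auto
  then have "card (s \<inter> t) \<le> card e" using assms(6) by simp
  then show ?thesis
    using card_seteq[of "s \<inter> t" e] fin assms(4,5) by auto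
qed

text \<open>A closed 2-dimensional pseudomanifold with connected dual graph; the links of vertices
  are unrestricted.\<close>

locale closed_surface =
  fixes \<Phi> :: "'a set set"
  assumes fin: "finite \<Phi>" and triple: "t \<in> \<Phi> \<Longrightarrow> card t = 3"
    and two: "e \<in> skel \<Phi> \<Longrightarrow> card {t \<in> \<Phi>. e \<subseteq> t} = 2"
    and conn: "strongly_connected \<Phi>"
begin

lemma finite_triple: "t \<in> \<Phi> \<Longrightarrow> finite t"
  using triple by (auto intro: card_ge_0_finite)

lemma finite_skel: "finite (skel \<Phi>)"
proof (rule finite_subset)
  show "skel \<Phi> \<subseteq> Pow (\<Union> \<Phi>)" by (auto simp: skel_def)
  show "finite (Pow (\<Union> \<Phi>))" using fin finite_triple by auto
qed

text \<open>Double counting of incidences: three sides per triangle, two triangles per side.\<close>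

lemma card_faces_edges: "3 * card \<Phi> = 2 * card (skel \<Phi>)"
proof -
  have "(\<Sum>e\<in>skel \<Phi>. card {t \<in> \<Phi>. e \<subseteq> t}) = (\<Sum>t\<in>\<Phi>. 3)"
  proof (rule sum_multicount_gen)
    show "\<forall>t\<in>\<Phi>. card {e \<in> skel \<Phi>. e \<subseteq> t} = 3"
    proof
      fix t assume t: "t \<in> \<Phi>"
      then have "{e \<in> skel \<Phi>. e \<subseteq> t} = {e. e \<subseteq> t \<and> card e = 2}"
        by (auto simp: skel_def)
      then show "card {e \<in> skel \<Phi>. e \<subseteq> t} = 3"
        using pairs_of_triple[OF triple[OF t]] by simp
    qed
  qed (use fin finite_skel in auto)
  moreover have "(\<Sum>e\<in>skel \<Phi>. card {t \<in> \<Phi>. e \<subseteq> t}) = (\<Sum>e\<in>skel \<Phi>. 2)"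
    using two by (intro sum.cong) auto
  ultimately show ?thesis by simp
qed

end

locale surface = closed_surface \<Phi> for \<Phi> :: "'a set set" +
  fixes M :: "'a set set"
  assumes M: "M \<subseteq> skel \<Phi>" "M \<noteq> {}" "finite M"
begin

section \<open>Intact and broken triangles\<close>

definition intact :: "'a set set" where
  "intact = {t \<in> \<Phi>. \<forall>e\<in>M. \<not> e \<subseteq> t}"

definition broken :: "'a set set" where
  "broken = {t \<in> \<Phi>. \<exists>e\<in>M. e \<subseteq> t}"

definition border :: "'a set set \<Rightarrow> 'a set set" where
  "border X = {e \<in> skel \<Phi>. (\<exists>t\<in>X. e \<subseteq> t) \<and> (\<exists>t\<in>broken. e \<subseteq> t)}"

text \<open>These are the unions of components of the dual graph on the intact triangles.\<close>

definition saturated :: "'a set set \<Rightarrow> bool" where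
  "saturated X \<longleftrightarrow> X \<subseteq> intact \<and> (\<forall>s\<in>X. \<forall>t\<in>intact. card (s \<inter> t) = 2 \<longrightarrow> t \<in> X)"

lemma intact_broken: "intact \<union> broken = \<Phi>" "intact \<inter> broken = {}"
  by (auto simp: intact_def broken_def)

lemma skelI: "t \<in> \<Phi> \<Longrightarrow> e \<subseteq> t \<Longrightarrow> card e = 2 \<Longrightarrow> e \<in> skel \<Phi>"
  by (auto simp: skel_def)

lemma no_three:
  assumes "s \<in> \<Phi>" "t \<in> \<Phi>" "r \<in> \<Phi>" "e \<subseteq> s" "e \<subseteq> t" "e \<subseteq> r" "card e = 2"
    "s \<noteq> t" "t \<noteq> r" "s \<noteq> r"
  shows False
proof -
  have "card {s, t, r} \<le> card {t \<in> \<Phi>. e \<subseteq> t}"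
    using assms fin by (intro card_mono) auto
  then show False
    using two[OF skelI[OF assms(1,4,7)]] assms(8-10) by simp
qed

lemma card_broken: "card broken \<le> 2 * card M"
proof -
  have "broken = (\<Union>e\<in>M. {t \<in> \<Phi>. e \<subseteq> t})"
    by (auto simp: broken_def)
  then have "card broken \<le> (\<Sum>e\<in>M. card {t \<in> \<Phi>. e \<subseteq> t})"
    using card_UN_le[OF M(3)] by simp
  also have "\<dots> = (\<Sum>e\<in>M. 2)"
    using two M(1) by (intro sum.cong) auto
  finally show ?thesis by simp
qed

lemma finite_region:
  assumes "R \<subseteq> \<Phi>"
  shows "finite R" "finite (skel R)"
proof -
  have "skel R \<subseteq> skel \<Phi>" using assms by (auto simp: skel_def)
  then show "finite R" "finite (skel R)"
    using assms fin finite_skel finite_subset by blast+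
qed

text \<open>A broken triangle has lost at least one of its three sides, and a lost side belongs to
  no intact triangle, so each broken triangle offers at most two border edges.\<close>

lemma card_border: "card (border intact) \<le> 2 * card broken"
proof -
  define P where "P t = {e. e \<subseteq> t \<and> card e = 2} - M" for t
  have "border intact \<subseteq> (\<Union>t\<in>broken. P t)"
    by (auto simp: P_def border_def intact_def skel_def)
  moreover have fb: "finite broken" using fin by (simp add: broken_def)
  moreover have "finite (P t)" "card (P t) \<le> 2" if t: "t \<in> broken" for t
  proof -
    have tt: "t \<in> \<Phi>" using t by (simp add: broken_def)
    have f: "finite {e. e \<subseteq> t \<and> card e = 2}"
      using finite_triple[OF tt] by simp
    then show "finite (P t)" by (simp add: P_def)
    obtain e where "e \<in> M" "e \<subseteq> t" using t by (auto simp: broken_def)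
    then have "e \<in> {e. e \<subseteq> t \<and> card e = 2}" "e \<notin> P t"
      using M(1) by (auto simp: P_def skel_def)
    then have "P t \<subset> {e. e \<subseteq> t \<and> card e = 2}" by (auto simp: P_def)
    then have "card (P t) < card {e. e \<subseteq> t \<and> card e = 2}"
      using f by (rule psubset_card_mono[rotated])
    then show "card (P t) \<le> 2"
      using pairs_of_triple[OF triple[OF tt]] by simp
  qed
  ultimately have "card (border intact) \<le> card (\<Union>t\<in>broken. P t)"
    by (intro card_mono) auto
  also have "\<dots> \<le> (\<Sum>t\<in>broken. card (P t))"
    using fb by (rule card_UN_le)
  also have "\<dots> \<le> (\<Sum>t\<in>broken. 2)"
    using \<open>\<And>t. t \<in> broken \<Longrightarrow> card (P t) \<le> 2\<close> by (intro sum_mono) auto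
  finally show ?thesis by simp
qed

lemma region_complex:
  assumes "R \<subseteq> \<Phi>" "strongly_connected R"
  shows "triangle_complex R"
proof
  show "card t = 3" if "t \<in> R" for t
    using triple assms(1) that by blast
  fix u v a b c
  assume *: "{u, v, a} \<in> R" "{u, v, b} \<in> R" "{u, v, c} \<in> R" "a \<noteq> b" "b \<noteq> c" "a \<noteq> c"
  have "card {u, v, x} = 3 \<Longrightarrow> u \<noteq> v \<and> x \<noteq> u \<and> x \<noteq> v" for x
    by (auto simp: card_insert_if split: if_splits)
  then have "u \<noteq> v" "a \<notin> {u, v}" "b \<notin> {u, v}" "c \<notin> {u, v}"
    using triple * assms(1) by blast+
  then show False
    using no_three[of "{u, v, a}" "{u, v, b}" "{u, v, c}" "{u, v}"] * assms(1)
    by (auto simp: doubleton_eq_iff insert_eq_iff)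
qed (fact assms(2))

lemma skel_region:
  assumes "R \<subseteq> intact"
  shows "skel R \<subseteq> skel \<Phi> - M"
  using assms by (auto simp: skel_def intact_def)

lemma other_triple:
  assumes "e \<in> skel \<Phi>" "t \<in> \<Phi>" "e \<subseteq> t"
  obtains t' where "t' \<in> \<Phi>" "t' \<noteq> t" "e \<subseteq> t'"
proof -
  have "card ({t \<in> \<Phi>. e \<subseteq> t} - {t}) = 1"
    using two[OF assms(1)] assms(2,3) by simp
  then obtain t' where "{t \<in> \<Phi>. e \<subseteq> t} - {t} = {t'}"
    by (auto simp: card_1_singleton_iff)
  then show ?thesis using that[of t'] by blast
qed

text \<open>The second triangle at \<open>e\<close> is either broken, which makes \<open>e\<close> a
  border edge, or intact and then in \<open>R\<close> by saturation.\<close>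

lemma incidences:
  assumes "saturated R" "e \<in> skel R"
  shows "card {t \<in> R. e \<subseteq> t} + of_bool (e \<in> border R) = 2"
proof -
  have R: "R \<subseteq> intact" "R \<subseteq> \<Phi>" using assms(1) by (auto simp: saturated_def intact_def)
  obtain t where t: "t \<in> R" "e \<subseteq> t" and e: "card e = 2"
    using assms(2) by (auto simp: skel_def)
  have tt: "t \<in> \<Phi>" "t \<notin> broken" using t(1) R intact_broken by blast+
  have es: "e \<in> skel \<Phi>" using skelI[OF tt(1) t(2) e] .
  obtain t' where t': "t' \<in> \<Phi>" "t' \<noteq> t" "e \<subseteq> t'"
    using other_triple[OF es tt(1) t(2)] by metis
  have only: "r = t \<or> r = t'" if "r \<in> \<Phi>" "e \<subseteq> r" for r
    using no_three[OF tt(1) t'(1) that(1) t(2) t'(3) that(2) e] t'(2) by blast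
  show ?thesis
  proof (cases "t' \<in> broken")
    case True
    then have "{t \<in> R. e \<subseteq> t} = {t}"
      using only t t' R intact_broken by blast
    moreover have "e \<in> border R"
      using True t t' es by (auto simp: border_def)
    ultimately show ?thesis by simp
  next
    case False
    then have "t' \<in> intact" using t' intact_broken by blast
    moreover have "t \<inter> t' = e"
      using card_Int_triples[OF triple[OF tt(1)] triple[OF t'(1)] t'(2)[symmetric] t(2) t'(3) e] .
    ultimately have "t' \<in> R"
      using assms(1) t(1) e unfolding saturated_def by metis
    then have "{t \<in> R. e \<subseteq> t} = {t, t'}"
      using only t t' R by blast
    moreover have "e \<notin> border R"
    proof
      assume "e \<in> border R"
      then obtain r where "r \<in> broken" "e \<subseteq> r" by (auto simp: border_def)
      then show False
        using only[of r] tt(2) False by (auto simp: broken_def)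
    qed
    ultimately show ?thesis using t'(2) by simp
  qed
qed

lemma border_subset:
  assumes "R \<subseteq> \<Phi>"
  shows "border R \<subseteq> skel R"
  using assms by (auto simp: border_def skel_def)

lemma edge_count:
  assumes "saturated R"
  shows "3 * card R + card (border R) = 2 * card (skel R)"
proof -
  have R: "R \<subseteq> \<Phi>" using assms by (auto simp: saturated_def intact_def)
  note fR = finite_region[OF R]
  have "(\<Sum>e\<in>skel R. card {t \<in> R. e \<subseteq> t}) = (\<Sum>t\<in>R. 3)"
  proof (rule sum_multicount_gen)
    show "\<forall>t\<in>R. card {e \<in> skel R. e \<subseteq> t} = 3"
    proof
      fix t assume t: "t \<in> R"
      then have "{e \<in> skel R. e \<subseteq> t} = {e. e \<subseteq> t \<and> card e = 2}"
        by (auto simp: skel_def)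
      then show "card {e \<in> skel R. e \<subseteq> t} = 3"
        using pairs_of_triple[OF triple, of t] R t by auto
    qed
  qed (use fR in auto)
  moreover have "(\<Sum>e\<in>skel R. of_bool (e \<in> border R)) = card (border R)"
    using fR(2) border_subset[OF R] by (simp add: Int_absorb1 sum_of_bool_eq)
  moreover have "(\<Sum>e\<in>skel R. card {t \<in> R. e \<subseteq> t} + of_bool (e \<in> border R)) = (\<Sum>e\<in>skel R. 2)"
    using incidences[OF assms] by (intro sum.cong) auto
  ultimately show ?thesis
    by (simp add: sum.distrib)
qed

text \<open>Sum \<open>incidences\<close> over the edges at \<open>u\<close>: every triangle of
  \<open>R\<close> at \<open>u\<close> has two sides there. So the border is a cycle modulo
  2.\<close>

lemma even_border_degree:
  assumes "saturated R"
  shows "even (card {e \<in> border R. u \<in> e})"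
proof -
  have R: "R \<subseteq> \<Phi>" using assms by (auto simp: saturated_def intact_def)
  let ?S = "{e \<in> skel R. u \<in> e}"
  have fR: "finite R" "finite ?S"
    using finite_region[OF R] by simp_all
  have "(\<Sum>e\<in>?S. card {t \<in> R. e \<subseteq> t}) = (\<Sum>t\<in>R. if u \<in> t then 2 else 0)"
  proof (rule sum_multicount_gen)
    show "\<forall>t\<in>R. card {e \<in> ?S. e \<subseteq> t} = (if u \<in> t then 2 else 0)"
    proof
      fix t assume t: "t \<in> R"
      show "card {e \<in> ?S. e \<subseteq> t} = (if u \<in> t then 2 else 0)"
      proof (cases "u \<in> t")
        case True
        have "{e \<in> ?S. e \<subseteq> t} = {e. e \<subseteq> t \<and> card e = 2 \<and> u \<in> e}"
          using t by (auto simp: skel_def)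
        then show ?thesis
          using pairs_of_triple_at[OF triple True] R t True by auto
      next
        case False
        then have none: "{e \<in> ?S. e \<subseteq> t} = {}" by blast
        show ?thesis unfolding none using False by simp
      qed
    qed
  qed (use fR in auto)
  moreover have "(\<Sum>e\<in>?S. of_bool (e \<in> border R)) = card {e \<in> border R. u \<in> e}"
  proof -
    have "?S \<inter> border R = {e \<in> border R. u \<in> e}"
      using border_subset[OF R] by blast
    then show ?thesis using fR(2) by (simp add: sum_of_bool_eq)
  qed
  moreover have "(\<Sum>e\<in>?S. card {t \<in> R. e \<subseteq> t} + of_bool (e \<in> border R)) = (\<Sum>e\<in>?S. 2)"
    using incidences[OF assms] by (intro sum.cong) auto
  ultimately have "(\<Sum>t\<in>R. if u \<in> t then 2 else 0) + card {e \<in> border R. u \<in> e} = 2 * card ?S"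
    by (simp add: sum.distrib)
  moreover have "even (\<Sum>t\<in>R. if u \<in> t then 2 else (0::nat))"
    by (intro dvd_sum) auto
  ultimately show ?thesis by presburger
qed

text \<open>An empty border would make \<open>R\<close> all of \<open>\<Phi>\<close>, but some
  triangle is broken. By even degrees a border edge is continued by further border edges at both
  ends, and these differ because an edge is determined by its ends.\<close>

lemma three_border_edges:
  assumes "saturated R" "R \<noteq> {}"
  shows "card (border R) \<ge> 3"
proof -
  have R: "R \<subseteq> intact" "R \<subseteq> \<Phi>" using assms(1) by (auto simp: saturated_def intact_def)
  have fb: "finite (border R)"
    using finite_skel by (simp add: border_def)
  have "border R \<noteq> {}"
  proof
    assume no: "border R = {}"
    have "t' \<in> R" if "t \<in> R" "t' \<in> \<Phi>" "card (t \<inter> t') = 2" for t t'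
    proof -
      have "t' \<notin> broken"
        using no that skelI[of t "t \<inter> t'"] R(2) unfolding border_def by blast
      then show ?thesis
        using that assms(1) intact_broken unfolding saturated_def by blast
    qed
    then have "R = \<Phi>"
      using conn R(2) assms(2) unfolding strongly_connected_def by blast
    moreover have "broken \<noteq> {}"
      using M by (auto simp: broken_def skel_def)
    ultimately show False using R intact_broken by blast
  qed
  then obtain e where e: "e \<in> border R" by blast
  then obtain u v where uv: "e = {u, v}" "u \<noteq> v"
    by (auto simp: border_def skel_def card_2_iff)
  have another: "\<exists>f\<in>border R. w \<in> f \<and> f \<noteq> e" if "w \<in> e" for w
  proof (rule ccontr)
    assume "\<not> ?thesis"
    then have "{f \<in> border R. w \<in> f} = {e}" using e that by blast
    then show False using even_border_degree[OF assms(1), of w] by simp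
  qed
  obtain f where f: "f \<in> border R" "u \<in> f" "f \<noteq> e" using another[of u] uv by auto
  obtain g where g: "g \<in> border R" "v \<in> g" "g \<noteq> e" using another[of v] uv by auto
  have "f \<noteq> g"
  proof
    assume "f = g"
    then have "e \<subseteq> f" using f g uv by simp
    moreover have "card f = 2" "card e = 2"
      using f(1) e by (simp_all add: border_def skel_def)
    ultimately show False
      using f(3) card_subset_eq[of f e] by (metis card.infinite zero_neq_numeral)
  qed
  then have "card {e, f, g} = 3" using f g by simp
  then show ?thesis
    using card_mono[OF fb, of "{e, f, g}"] e f g by auto
qed

text \<open>\<open>R\<close> is the component of \<open>t\<close> in the dual graph on the intact
  triangles; by minimality it can be split off from any saturated set around it.\<close>

lemma component:
  assumes "t \<in> intact"
  obtains R where "t \<in> R" "saturated R" "strongly_connected R"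
    "\<And>X. saturated X \<Longrightarrow> t \<in> X \<Longrightarrow> R \<subseteq> X"
proof -
  define adj where "adj = {(s, t). s \<in> intact \<and> t \<in> intact \<and> card (s \<inter> t) = 2}"
  define R where "R = {s. (t, s) \<in> adj\<^sup>*}"
  have sym: "sym (adj\<^sup>*)"
    by (rule sym_rtrancl) (auto simp: adj_def sym_def Int_commute)
  have min: "R \<subseteq> X" if "saturated X" "t \<in> X" for X
  proof
    fix s assume "s \<in> R"
    then have "(t, s) \<in> adj\<^sup>*" by (simp add: R_def)
    then show "s \<in> X"
      by induction (use that in \<open>auto simp: adj_def saturated_def\<close>)
  qed
  have "R \<subseteq> intact"
    by (rule min) (use assms in \<open>auto simp: saturated_def\<close>)
  moreover have "r \<in> R" if "s \<in> R" "r \<in> intact" "card (s \<inter> r) = 2" for s r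
  proof -
    have "(s, r) \<in> adj" using that \<open>R \<subseteq> intact\<close> by (auto simp: adj_def)
    then show ?thesis using that(1) by (simp add: R_def rtrancl_into_rtrancl)
  qed
  ultimately have sat: "saturated R" by (simp add: saturated_def)
  have "S = R" if S: "S \<subseteq> R" "S \<noteq> {}" "\<forall>s\<in>S. \<forall>r\<in>R. card (s \<inter> r) = 2 \<longrightarrow> r \<in> S" for S
  proof -
    obtain s where s: "s \<in> S" using S(2) by blast
    have "r \<in> S" if "r \<in> R" for r
    proof -
      have "(s, t) \<in> adj\<^sup>*" "(t, r) \<in> adj\<^sup>*"
        using s S(1) that sym by (auto simp: R_def dest: symD)
      then have "(s, r) \<in> adj\<^sup>*" by (rule rtrancl_trans)
      then show ?thesis
      proof induction
        case base show ?case by (fact s)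
      next
        case (step y z)
        then have "z \<in> R"
          using S(1) sat by (auto simp: adj_def saturated_def)
        then show ?case using S(3) step by (auto simp: adj_def)
      qed
    qed
    then show ?thesis using S(1) by blast
  qed
  then have "strongly_connected R" by (auto simp: strongly_connected_def)
  moreover have "t \<in> R" by (simp add: R_def)
  ultimately show ?thesis using that sat min by blast
qed

text \<open>Components are split off one by one, and both sides of the inequality are
  additive.\<close>

lemma border_bound:
  assumes bound: "\<And>R. R \<noteq> {} \<Longrightarrow> saturated R \<Longrightarrow> strongly_connected R \<Longrightarrow> 2 * card R \<le> c * card (border R)"
  assumes "saturated X"
  shows "2 * card X \<le> c * card (border X)"
proof -
  have "X \<subseteq> \<Phi>" using assms(2) by (auto simp: saturated_def intact_def)
  then have "finite X" using fin finite_subset by blast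
  then show ?thesis using assms(2)
  proof (induction X rule: finite_psubset_induct)
    case (psubset X)
    show ?case
    proof (cases "X = {}")
      case False
      then obtain t where t: "t \<in> X" by blast
      then have "t \<in> intact" using psubset.prems by (auto simp: saturated_def)
      then obtain R where R: "t \<in> R" "saturated R" "strongly_connected R" "R \<subseteq> X"
        using component[of t] psubset.prems t by metis
      have sat: "saturated (X - R)"
        using psubset.prems R(2) unfolding saturated_def by (metis Diff_iff Int_commute subset_iff)
      have "border X = border R \<union> border (X - R)"
        using R(4) by (auto simp: border_def)
      \<comment> \<open>A common border edge would lie in two intact triangles and a broken one,
        three in all.\<close>
      moreover have "border R \<inter> border (X - R) = {}"
      proof (rule ccontr)
        assume "\<not> ?thesis"
        then obtain e t1 t2 t3 where "card e = 2" "t1 \<in> R" "e \<subseteq> t1" "t2 \<in> X - R" "e \<subseteq> t2"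
          "t3 \<in> broken" "e \<subseteq> t3"
          by (auto simp: border_def skel_def)
        moreover have "R \<subseteq> intact" "X \<subseteq> intact"
          using R(2) psubset.prems by (auto simp: saturated_def)
        ultimately show False
          using no_three[of t1 t2 t3 e] intact_broken by blast
      qed
      moreover have "finite (border Y)" for Y
        using finite_skel by (simp add: border_def)
      ultimately have "card (border X) = card (border R) + card (border (X - R))"
        by (simp add: card_Un_disjoint)
      moreover have "card X = card R + card (X - R)"
        using psubset.hyps R(4) by (metis card_Diff_subset card_mono finite_subset le_add_diff_inverse)
      moreover have "2 * card (X - R) \<le> c * card (border (X - R))"
        using psubset.IH[of "X - R"] sat R(1) t by blast
      moreover have "2 * card R \<le> c * card (border R)"
        using bound[of R] R by blast
      ultimately show ?thesis by (simp add: algebra_simps)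
    qed simp
  qed
qed

text \<open>Twice the number of intact triangles is at most \<open>c * card (border intact)\<close>,
  hence at most \<open>2 * c * card broken\<close>. So there are at most \<open>c + 1\<close> times
  as many triangles as broken ones, and each deleted edge breaks at most two.\<close>

lemma face_bound:
  assumes "\<And>R. R \<noteq> {} \<Longrightarrow> saturated R \<Longrightarrow> strongly_connected R \<Longrightarrow> 2 * card R \<le> c * card (border R)"
  shows "card \<Phi> \<le> 2 * (c + 1) * card M"
proof -
  have "2 * card intact \<le> c * card (border intact)"
    by (rule border_bound[OF assms]) (auto simp: saturated_def)
  also have "\<dots> \<le> c * (2 * card broken)"
    using card_border by simp
  finally have "card intact \<le> c * card broken" by simp
  moreover have "card \<Phi> = card intact + card broken"
    using intact_broken fin by (metis card_Un_disjoint finite_Un)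
  ultimately have "card \<Phi> \<le> (c + 1) * card broken" by simp
  also have "\<dots> \<le> (c + 1) * (2 * card M)"
    using card_broken by (rule mult_le_mono2)
  finally show ?thesis by (simp add: algebra_simps)
qed

text \<open>Bounds the number of edges in \<open>edge_count\<close> by the number of all pairs of
  vertices.\<close>

lemma region_bound:
  assumes "saturated R" "card (\<Union> R) \<le> v"
  shows "3 * card R + card (border R) \<le> v * (v - 1)"
proof -
  have R: "R \<subseteq> \<Phi>" using assms by (auto simp: saturated_def intact_def)
  have f: "finite (\<Union> R)"
    using R fin finite_triple by (meson finite_Union finite_subset subsetD)
  have "skel R \<subseteq> {e. e \<subseteq> \<Union> R \<and> card e = 2}"
    by (auto simp: skel_def)
  then have "card (skel R) \<le> card {e. e \<subseteq> \<Union> R \<and> card e = 2}"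
    using f by (intro card_mono) auto
  also have "\<dots> = card (\<Union> R) * (card (\<Union> R) - 1) div 2"
    using n_subsets[OF f, of 2] by (simp add: choose_two)
  finally have "2 * card (skel R) \<le> card (\<Union> R) * (card (\<Union> R) - 1)" by linarith
  also have "\<dots> \<le> v * (v - 1)"
    using assms(2) by (intro mult_le_mono) auto
  finally show ?thesis using edge_count[OF assms(1)] by simp
qed

lemma six_cycle_or_few_faces:
  assumes "\<not> has_cycle (skel \<Phi> - M) 6"
  shows "card \<Phi> \<le> 12 * card M"
proof -
  have "2 * card R \<le> 5 * card (border R)"
    if "R \<noteq> {}" "saturated R" "strongly_connected R" for R
  proof -
    have R: "R \<subseteq> intact" "R \<subseteq> \<Phi>" using that by (auto simp: saturated_def intact_def)
    have "\<not> has_cycle (skel R) 6"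
      using assms has_cycle_mono skel_region[OF R(1)] by blast
    then have "card (\<Union> R) \<le> 5"
      using triangle_complex.six_cycle[OF region_complex[OF R(2) that(3)]] by force
    \<comment> \<open>From \<open>3 * card R + card (border R) \<le> 20\<close> and at least 3
      border edges, \<open>card R \<le> 5\<close>, so
      \<open>2 * card R \<le> 10 \<le> 5 * 3\<close>. The factor 5 becomes
      \<open>2 * (5 + 1) = 12\<close>.\<close>
    then show ?thesis
      using region_bound[OF that(2), of 5] three_border_edges[OF that(2,1)] by simp
  qed
  then show ?thesis using face_bound[of 5] by simp
qed

lemma seven_cycle_or_few_faces:
  assumes "\<not> has_cycle (skel \<Phi> - M) 7"
  shows "card \<Phi> \<le> 40 * card M"
proof -
  have "2 * card R \<le> 19 * card (border R)"
    if "R \<noteq> {}" "saturated R" "strongly_connected R" for R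
  proof -
    have R: "R \<subseteq> intact" "R \<subseteq> \<Phi>" using that by (auto simp: saturated_def intact_def)
    have "\<not> has_cycle (skel R) 7"
      using assms has_cycle_mono skel_region[OF R(1)] by blast
    then have "card (\<Union> R) \<le> 7"
      using triangle_complex.seven_cycle[OF region_complex[OF R(2) that(3)]] by force
    \<comment> \<open>Here \<open>3 * card R + card (border R) \<le> 42\<close> gives
      \<open>card R \<le> 13\<close>, and \<open>26 \<le> 19 * 3\<close>. The factor 19 becomes
      \<open>2 * (19 + 1) = 40\<close>.\<close>
    then show ?thesis
      using region_bound[OF that(2), of 7] three_border_edges[OF that(2,1)] by simp
  qed
  then show ?thesis using face_bound[of 19] by simp
qed

end

section \<open>The anti-Ramsey bounds\<close>

context triangulated_drawing
begin

definition triples :: "complex set set" where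
  "triples = tri ` \<F>"

lemma card_edge: "e \<in> E \<Longrightarrow> card e = 2"
  by (erule edgeE) simp

lemma skel_triples: "skel triples = E"
proof
  show "skel triples \<subseteq> E"
    using tri_edges by (auto simp: skel_def triples_def)
  show "E \<subseteq> skel triples"
  proof
    fix e assume e: "e \<in> E"
    then obtain F where "F \<in> \<F>" "e \<subseteq> tri F"
      by (rule edge_two_faces)
    then show "e \<in> skel triples"
      using card_edge[OF e] by (auto simp: skel_def triples_def)
  qed
qed

lemma card_triples: "card triples = card \<F>"
  unfolding triples_def by (rule card_image) (rule inj_tri)

text \<open>By \<open>inj_tri\<close> the statements about faces carry over to corner triples: the
  two faces at an edge give \<open>two\<close>, and \<open>dual_connected\<close> gives
  \<open>conn\<close>.\<close>

sublocale closed_surface triples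
proof
  show "finite triples" by (simp add: triples_def finite_faces)
  show card3: "card t = 3" if "t \<in> triples" for t
    using that tri_card by (auto simp: triples_def)
  show "card {t \<in> triples. e \<subseteq> t} = 2" if "e \<in> skel triples" for e
  proof -
    have e: "e \<in> E" using that skel_triples by simp
    obtain F1 F2 where F: "F1 \<in> \<F>" "F2 \<in> \<F>" "F1 \<noteq> F2" "e \<subseteq> tri F1" "e \<subseteq> tri F2"
      using edge_two_faces[OF e] by metis
    have "F = F1 \<or> F = F2" if "F \<in> \<F>" "e \<subseteq> tri F" for F
      using edge_at_most_two_faces[OF e F(1,2) that(1) F(4,5) that(2) F(3)] by metis
    then have "{t \<in> triples. e \<subseteq> t} = {tri F1, tri F2}"
      using F by (auto simp: triples_def)
    moreover have "tri F1 \<noteq> tri F2"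
      using inj_tri F(1-3) by (auto dest: inj_onD)
    ultimately show ?thesis by simp
  qed
  show "strongly_connected triples"
    unfolding strongly_connected_def
  proof (intro allI impI)
    fix S
    assume S: "S \<subseteq> triples" "S \<noteq> {}"
      "\<forall>t\<in>S. \<forall>t'\<in>triples. card (t \<inter> t') = 2 \<longrightarrow> t' \<in> S"
    have "{F \<in> \<F>. tri F \<in> S} = \<F>"
    proof (rule dual_connected)
      show "{F \<in> \<F>. tri F \<in> S} \<noteq> {}"
        using S(1,2) by (auto simp: triples_def)
      fix F F' e
      assume a: "F \<in> {F \<in> \<F>. tri F \<in> S}" "F' \<in> \<F>" "e \<in> E" "e \<subseteq> tri F" "e \<subseteq> tri F'"
      show "F' \<in> {F \<in> \<F>. tri F \<in> S}"
      proof (cases "F = F'")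
        case False
        then have "tri F \<noteq> tri F'" using inj_tri a by (auto dest: inj_onD)
        then have "tri F \<inter> tri F' = e"
          using a tri_card card_edge by (intro card_Int_triples) auto
        then show ?thesis
          using a S(3) card_edge[OF a(3)] by (auto simp: triples_def)
      qed (use a in auto)
    qed auto
    then show "S = triples" using S(1) by (auto simp: triples_def)
  qed
qed

text \<open>The drawing has at least one component, which accounts for the \<open>2\<close> in
  Euler's inequality.\<close>

lemma euler_triples: "card E + 2 \<le> card V + card triples"
proof -
  have "V \<noteq> {}" using four_verts by auto
  then have "num_comps E \<ge> 1"
    unfolding num_comps_def using finV by (simp add: Suc_leI card_gt_0_iff)
  moreover have "num_faces E = card triples"
    unfolding num_faces_def card_triples by (simp add: faces_draw)
  ultimately show ?thesis
    using euler_inequality[of E] finite_faces by (simp add: faces_draw)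
qed

end

text \<open>The isomorphism onto \<open>cycle_graph k\<close> sends a vertex to its index in the
  list.\<close>

lemma copy_of_has_cycle:
  assumes T: "simple_graph T" and A: "A \<subseteq> edges T" and cyc: "has_cycle A k" and k: "k \<ge> 3"
  obtains S where "copy_of S (cycle_graph k) T" "edges S \<subseteq> A"
proof -
  obtain xs where xs: "length xs = k" "distinct xs"
    "successively (\<lambda>a b. {a, b} \<in> A) xs" "{last xs, hd xs} \<in> A"
    using cyc by (auto simp: has_cycle_def)
  have ne: "xs \<noteq> []" using xs(1) k by auto
  let ?h = "\<lambda>i. xs ! i"
  define S :: "'a graph" where "S = \<lparr>verts = set xs, edges = (\<lambda>i. {?h i, ?h ((i + 1) mod k)}) ` {..<k}\<rparr>"
  have inA: "{?h i, ?h ((i + 1) mod k)} \<in> A" if "i < k" for i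
  proof (cases "i + 1 < k")
    case True
    then show ?thesis using xs(1,3) by (auto simp: successively_conv_nth)
  next
    case False
    \<comment> \<open>The index \<open>k - 1\<close> wraps around to 0 and gives the closing edge of
      the cycle.\<close>
    then have "i + 1 = k" using that by simp
    then have "i = k - 1" "(i + 1) mod k = 0" by auto
    then show ?thesis using xs(1,4) ne by (simp add: last_conv_nth hd_conv_nth)
  qed
  then have sub: "edges S \<subseteq> A" by (auto simp: S_def)
  have vT: "v \<in> verts T" if "v \<in> e" "e \<in> edges T" for v e
    using T that by (auto simp: simple_graph_def)
  have "verts S \<subseteq> verts T"
  proof
    fix v assume "v \<in> verts S"
    then obtain i where "i < k" "v = ?h i"
      using xs(1) by (auto simp: S_def in_set_conv_nth)
    then show "v \<in> verts T"
      using inA[of i] A by (intro vT[of v "{?h i, ?h ((i + 1) mod k)}"]) auto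
  qed
  moreover have "simple_graph S"
    unfolding simple_graph_def
  proof (intro conjI ballI)
    show "finite (verts S)" by (simp add: S_def)
    fix e assume "e \<in> edges S"
    then obtain i where i: "i < k" "e = {?h i, ?h ((i + 1) mod k)}" by (auto simp: S_def)
    have j: "(i + 1) mod k < k" "(i + 1) mod k \<noteq> i"
      using i(1) k by (auto simp: mod_Suc)
    then have "?h i \<noteq> ?h ((i + 1) mod k)"
      using i(1) xs(1,2) by (simp add: nth_eq_iff_index_eq)
    moreover have "?h i \<in> verts S" "?h ((i + 1) mod k) \<in> verts S"
      using nth_mem[of i xs] nth_mem[of "(i + 1) mod k" xs] i(1) j(1) xs(1) by (simp_all add: S_def)
    ultimately show "\<exists>u\<in>verts S. \<exists>v\<in>verts S. u \<noteq> v \<and> e = {u, v}"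
      using i(2) by blast
  qed
  moreover have "graph_iso S (cycle_graph k)"
  proof -
    have bij: "bij_betw ?h {..<k} (set xs)"
      using bij_betw_nth[OF xs(2)] xs(1) by simp
    then have inj: "inj_on ?h {..<k}" by (rule bij_betw_imp_inj_on)
    let ?g = "inv_into {..<k} ?h"
    have g: "bij_betw ?g (set xs) {..<k}"
      using bij by (rule bij_betw_inv_into)
    have "{u, v} \<in> edges S \<longleftrightarrow> {?g u, ?g v} \<in> edges (cycle_graph k)"
      if uv: "u \<in> set xs" "v \<in> set xs" for u v
    proof -
      obtain i j where ij: "i < k" "j < k" "u = ?h i" "v = ?h j"
        using uv xs(1) by (auto simp: in_set_conv_nth)
      then have gi: "?g u = i" "?g v = j"
        using inj by (auto simp: inv_into_f_f)
      \<comment> \<open>Since \<open>xs\<close> is distinct, equal pairs of entries come from equal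
        pairs of indices.\<close>
      have "?h ` {i, j} = ?h ` {l, (l + 1) mod k} \<longleftrightarrow> {i, j} = {l, (l + 1) mod k}" if "l < k" for l
        using ij(1,2) that k by (intro inj_on_image_eq_iff[OF inj]) auto
      then have "(\<exists>l<k. {?h i, ?h j} = {?h l, ?h ((l + 1) mod k)}) \<longleftrightarrow>
          (\<exists>l<k. {i, j} = {l, (l + 1) mod k})"
        by auto
      moreover have "{?h i, ?h j} \<in> edges S \<longleftrightarrow> (\<exists>l<k. {?h i, ?h j} = {?h l, ?h ((l + 1) mod k)})"
        by (auto simp: S_def)
      moreover have "{i, j} \<in> edges (cycle_graph k) \<longleftrightarrow> (\<exists>l<k. {i, j} = {l, (l + 1) mod k})"
        by (auto simp: cycle_graph_def)
      ultimately show ?thesis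
        unfolding gi unfolding ij(3,4) by blast
    qed
    then show ?thesis
      unfolding graph_iso_def using g by (intro exI[of _ ?g]) (simp add: S_def cycle_graph_def)
  qed
  ultimately have "copy_of S (cycle_graph k) T"
    using sub A by (auto simp: copy_of_def subgraph_of_def)
  then show ?thesis using that sub by blast
qed

text \<open>\<open>M\<close> is the complement of a set of edges representing each color once.\<close>

lemma rainbow_free_surface:
  assumes T: "T \<in> triangulations_containing n (cycle_graph k)" and nk: "n \<ge> 4" "k \<ge> 3"
    and free: "\<not> (\<exists>S. copy_of S (cycle_graph k) T \<and> rainbow (c :: complex set \<Rightarrow> nat) S)"
  obtains \<Phi> M :: "complex set set" where "surface \<Phi> M" "\<not> has_cycle (skel \<Phi> - M) k"
    "card (c ` edges T) + card M = card (skel \<Phi>)" "card (skel \<Phi>) + 2 \<le> n + card \<Phi>"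
proof -
  have tr: "plane_triangulation T" "card (verts T) = n" and "\<exists>S. copy_of S (cycle_graph k) T"
    using T by (auto simp: triangulations_containing_def)
  then obtain S where S: "copy_of S (cycle_graph k) T" by blast
  interpret triangulated_drawing T
    using tr nk by unfold_locales (auto simp: plane_triangulation_def)
  \<comment> \<open>\<open>U\<close> contains one edge of each color, so every subgraph with edges
    in \<open>U\<close> is rainbow.\<close>
  obtain U where U: "U \<subseteq> E" "inj_on c U" "c ` E = c ` U"
    using subset_image_inj[of "c ` E" c E] by auto
  have skel: "skel triples = E" by (fact skel_triples)
  \<comment> \<open>If nothing were deleted, the coloring would be injective and the copy
    \<open>S\<close>, present by the choice of the family of triangulations, would be
    rainbow.\<close>
  have "E - U \<noteq> {}"
  proof
    assume "E - U = {}"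
    then have "inj_on c E" using U by (metis Diff_eq_empty_iff subset_antisym)
    then have "rainbow c S"
      using S unfolding rainbow_def copy_of_def subgraph_of_def by (metis inj_on_subset)
    then show False using free S by blast
  qed
  then have surf: "surface triples (E - U)"
    using finE skel by unfold_locales auto
  have "skel triples - (E - U) = U" using skel U(1) by blast
  moreover have "\<not> has_cycle U k"
  proof
    assume "has_cycle U k"
    moreover have "simple_graph T" using plane by (simp add: is_plane_graph_def)
    ultimately obtain S' where "copy_of S' (cycle_graph k) T" "edges S' \<subseteq> U"
      using copy_of_has_cycle U(1) nk(2) by metis
    then show False
      using free U(2) unfolding rainbow_def by (metis inj_on_subset)
  qed
  ultimately have "\<not> has_cycle (skel triples - (E - U)) k" by simp
  moreover have "card (c ` E) + card (E - U) = card (skel triples)"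
    using U finE skel by (metis card_Diff_subset card_image card_mono finite_subset le_add_diff_inverse)
  moreover have "card (skel triples) + 2 \<le> n + card triples"
    using euler_triples skel tr(2) by simp
  ultimately show ?thesis by (rule that[OF surf])
qed

text \<open>The case \<open>b \<ge> 0\<close> takes care of an empty set of counts, whose supremum
  is 0.\<close>

lemma planar_anti_ramsey_le:
  assumes "\<And>m. m \<in> rainbow_free_color_counts n H \<Longrightarrow> real m \<le> b" "b \<ge> 0"
  shows "real (planar_anti_ramsey n H) \<le> b"
proof (cases "rainbow_free_color_counts n H = {}")
  case True
  then show ?thesis using assms(2) by (simp add: planar_anti_ramsey_def)
next
  case False
  then show ?thesis
    using assms(1) Max_in[OF finite_rainbow_free_color_counts False]
    by (simp add: planar_anti_ramsey_eq_Max)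
qed

theorem theorem3p7:
  "(\<forall>n::nat. n \<ge> 8 \<longrightarrow>
      real (planar_anti_ramsey n (cycle_graph 6)) \<le> 17 * (real n - 2) / 6) \<and>
   (\<forall>n::nat. n \<ge> 13 \<longrightarrow>
      real (planar_anti_ramsey n (cycle_graph 7)) \<le> (59 * real n - 113) / 20)"
proof (intro conjI allI impI)
  fix n :: nat assume n: "n \<ge> 8"
  show "real (planar_anti_ramsey n (cycle_graph 6)) \<le> 17 * (real n - 2) / 6"
  proof (rule planar_anti_ramsey_le)
    fix m assume "m \<in> rainbow_free_color_counts n (cycle_graph 6)"
    then obtain T and c :: "complex set \<Rightarrow> nat"
      where *: "T \<in> triangulations_containing n (cycle_graph 6)" "m = card (c ` edges T)"
        "\<not> (\<exists>S. copy_of S (cycle_graph 6) T \<and> rainbow c S)"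
      by (auto simp: rainbow_free_color_counts_def)
    have n4: "n \<ge> 4" "(6::nat) \<ge> 3" using n by simp_all
    obtain \<Phi> M :: "complex set set" where S: "surface \<Phi> M" "\<not> has_cycle (skel \<Phi> - M) 6"
      "m + card M = card (skel \<Phi>)" "card (skel \<Phi>) + 2 \<le> n + card \<Phi>"
      unfolding *(2) by (rule rainbow_free_surface[OF *(1) n4 *(3)])
    have "card \<Phi> \<le> 12 * card M" "3 * card \<Phi> = 2 * card (skel \<Phi>)"
      using surface.six_cycle_or_few_faces[OF S(1,2)]
        closed_surface.card_faces_edges[OF surface.axioms(1)[OF S(1)]] .
    \<comment> \<open>With \<open>f = card \<Phi>\<close> there are \<open>3 * f / 2\<close> edges,
      and Euler's inequality gives \<open>f \<le> 2 * n - 4\<close>. At least \<open>f / 12\<close>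
      edges are deleted, so \<open>m \<le> 3 * f / 2 - f / 12 = 17 * f / 12\<close>.\<close>
    then have "6 * m + 34 \<le> 17 * n" using S(3,4) by linarith
    then have "real (6 * m + 34) \<le> real (17 * n)" by (rule of_nat_mono)
    then show "real m \<le> 17 * (real n - 2) / 6" by simp
  qed (use n in simp)
next
  fix n :: nat assume n: "n \<ge> 13"
  show "real (planar_anti_ramsey n (cycle_graph 7)) \<le> (59 * real n - 113) / 20"
  proof (rule planar_anti_ramsey_le)
    fix m assume "m \<in> rainbow_free_color_counts n (cycle_graph 7)"
    then obtain T and c :: "complex set \<Rightarrow> nat"
      where *: "T \<in> triangulations_containing n (cycle_graph 7)" "m = card (c ` edges T)"
        "\<not> (\<exists>S. copy_of S (cycle_graph 7) T \<and> rainbow c S)"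
      by (auto simp: rainbow_free_color_counts_def)
    have n4: "n \<ge> 4" "(7::nat) \<ge> 3" using n by simp_all
    obtain \<Phi> M :: "complex set set" where S: "surface \<Phi> M" "\<not> has_cycle (skel \<Phi> - M) 7"
      "m + card M = card (skel \<Phi>)" "card (skel \<Phi>) + 2 \<le> n + card \<Phi>"
      unfolding *(2) by (rule rainbow_free_surface[OF *(1) n4 *(3)])
    have "card \<Phi> \<le> 40 * card M" "3 * card \<Phi> = 2 * card (skel \<Phi>)"
      using surface.seven_cycle_or_few_faces[OF S(1,2)]
        closed_surface.card_faces_edges[OF surface.axioms(1)[OF S(1)]] .
    \<comment> \<open>Now \<open>m \<le> 3 * f / 2 - f / 40 = 59 * f / 40\<close>, which is at most
      \<open>59 * (n - 2) / 20\<close>. The constant \<open>118 = 59 * 2\<close> is slightly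
      stronger than the 113 to be shown.\<close>
    then have "20 * m + 118 \<le> 59 * n" using S(3,4) by linarith
    then have "real (20 * m + 118) \<le> real (59 * n)" by (rule of_nat_mono)
    then show "real m \<le> (59 * real n - 113) / 20" by simp
  qed (use n in simp)
qed

end
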